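(* Let $\alpha$ and $\beta$ be countable ordinals with $\beta\le \alpha+1$ and $(\alpha,\beta)\neq(0,0)$. Then there exists a Banach space with an $(\alpha,\beta)$-quasi-greedy basis, that is, a basis which is quasi-greedy, $\mathcal{S}_\alpha$-unconditional but not $\mathcal{S}_{\alpha+1}$-unconditional, and $\mathcal{S}_\beta$-democratic but not $\mathcal{S}_{\beta+1}$-democratic.
   Context: Banach spaces are over $\mathbb{F}=\mathbb{R}$ or $\mathbb{C}$. $\mathbb{N}=\{1,2,\dots\}$ and $[\mathbb{N}]^{<\infty}$ is the set of finite subsets of $\mathbb{N}$. "Basis" means semi-normalized Schauder basis $(e_i)_{i=1}^\infty$ of a Banach space $X$: $0<\inf_i\|e_i\|\le\sup_i\|e_i\|<\infty$ and every $x\in X$ has a unique expansion $x=\sum_i e_i^*(x)e_i$, with coefficient functionals $e_i^*\in X^*$. For $A\in[\mathbb{N}]^{<\infty}$ put $1_A=\sum_{i\in A}e_i$ and $P_A(x)=\sum_{i\in A}e_i^*(x)e_i$. Schreier families. For $A,B\subset\mathbb{N}$, $A<B$ means $\max A<\min B$; for $m\in\mathbb{N}$, $m\le A$ means $m\le a$ for all $a\in A$. For each countable ordinal $\alpha$: $\mathcal{S}_0=\{\emptyset\}\cup\{\{n\}:n\in\mathbb{N}\}$; $\mathcal{S}_{\beta+1}=\{\emptyset\}\cup\{\bigcup_{i=1}^kE_i: k\in\mathbb{N},\ E_1,\dots,E_k\in\mathcal{S}_\beta \text{ nonempty},\ k\le E_1<E_2<\dots<E_k\}$; for a limit ordinal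 $\alpha$ one fixes a sequence of successor ordinals $(\lambda(\alpha,i))_{i\ge1}$ increasing to $\alpha$ such that $\mathcal{S}_{\lambda(\alpha,i)}\subset\mathcal{S}_{\lambda(\alpha,i+1)}$ for all $i$ (this is possible), and sets $\mathcal{S}_\alpha=\{E\in[\mathbb{N}]^{<\infty}:\exists m\le E,\ E\in\mathcal{S}_{\lambda(\alpha,m)+1}\}$. These choices are fixed throughout. A greedy set of order $m$ of $x$ is a set $\Lambda\subset\mathbb{N}$ with $|\Lambda|=m$ and $\min_{i\in\Lambda}|e_i^*(x)|\ge\max_{i\notin\Lambda}|e_i^*(x)|$; an $m$th greedy approximation of $x$ is $\mathcal{G}_m(x)=P_\Lambda(x)$. The basis is quasi-greedy if $\lim_m\mathcal{G}_m(x)=x$ for all $x$; equivalently, if there is $C>0$ with $\|\mathcal{G}_m(x)\|\le C\|x\|$ for all $x\in X$, $m\in\mathbb{N}$. The basis is $\mathcal{S}_\alpha$-unconditional if there is $C>0$ with $\|P_A(x)\|\le C\|x\|$ for all $x\in X$, $A\in\mathcal{S}_\alpha$. It is $\mathcal{S}_\alpha$-democratic if there is $C>0$ with $\|1_A\|\le C\|1_B\|$ for all $A\in\mathcal{S}_\alpha$ and $B\in[\mathbb{N}]^{<\infty}$ with $|A|\le|B|$. *)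

theory Defs
  imports
    "HOL-Analysis.Analysis"
    "HOL-Library.Function_Algebras"
begin

section \<open>Countable ordinals\<close>

text \<open>
  The type of all countable ordinals, i.e. the elements of the ordinal \<open>\<omega>\<^sub>1\<close>: the field of the
  well-order \<open>cardSuc natLeq\<close>, the cardinal successor of \<open>\<aleph>\<^sub>0\<close>.
\<close>

typedef countable_ordinal = "Field (cardSuc natLeq)"
  morphisms Rep_ord Abs_ord
proof -
  have "\<not> finite (Field (cardSuc natLeq))"
    using cardSuc_finite[OF natLeq_Card_order] by (simp add: Field_natLeq)
  then show ?thesis
    by (metis ex_in_conv finite.emptyI)
qed

lemma Well_order_cardSuc_natLeq: "Well_order (cardSuc natLeq)"
  using cardSuc_Card_order[OF natLeq_Card_order] card_order_on_well_order_on by blast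

instantiation countable_ordinal :: wellorder
begin

definition less_eq_countable_ordinal :: "countable_ordinal \<Rightarrow> countable_ordinal \<Rightarrow> bool"
  where "x \<le> y \<longleftrightarrow> (Rep_ord x, Rep_ord y) \<in> cardSuc natLeq"

definition less_countable_ordinal :: "countable_ordinal \<Rightarrow> countable_ordinal \<Rightarrow> bool"
  where "x < y \<longleftrightarrow> x \<le> y \<and> \<not> y \<le> (x :: countable_ordinal)"

instance
proof
  note W = Well_order_cardSuc_natLeq
  have lin: "Linear_order (cardSuc natLeq)"
    using W by (simp add: well_order_on_def)
  then have refl: "Refl (cardSuc natLeq)" and tr: "trans (cardSuc natLeq)"
    and anti: "antisym (cardSuc natLeq)" and tot: "Total (cardSuc natLeq)"
    by (auto simp: order_on_defs)
  fix x y z :: countable_ordinal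
  show "x < y \<longleftrightarrow> x \<le> y \<and> \<not> y \<le> x"
    by (simp add: less_countable_ordinal_def)
  show rx: "x \<le> x" for x :: countable_ordinal
    using refl Rep_ord[of x] by (simp add: less_eq_countable_ordinal_def refl_on_def)
  show "x \<le> y \<Longrightarrow> y \<le> z \<Longrightarrow> x \<le> z"
    using tr unfolding less_eq_countable_ordinal_def trans_def by blast
  show as: "x \<le> y \<Longrightarrow> y \<le> x \<Longrightarrow> x = y" for x y :: countable_ordinal
    using anti unfolding less_eq_countable_ordinal_def antisym_def by (metis Rep_ord_inject)
  show tt: "x \<le> y \<or> y \<le> x" for x y :: countable_ordinal
    using tot rx Rep_ord[of x] Rep_ord[of y]
    unfolding less_eq_countable_ordinal_def total_on_def by metis
  fix P :: "countable_ordinal \<Rightarrow> bool" and a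
  assume step: "\<And>x. (\<And>y. y < x \<Longrightarrow> P y) \<Longrightarrow> P x"
  have wf: "wf (cardSuc natLeq - Id)"
    using W by (simp add: well_order_on_def)
  have lt: "(x :: countable_ordinal) < y \<longleftrightarrow> (Rep_ord x, Rep_ord y) \<in> cardSuc natLeq - Id" for x y
    unfolding less_countable_ordinal_def less_eq_countable_ordinal_def
    using as[of x y] rx[of x]
    by (auto simp: less_eq_countable_ordinal_def Rep_ord_inject)
  have "wf {(x, y). (x :: countable_ordinal) < y}"
    using wf_inv_image[OF wf, of Rep_ord] by (simp add: lt inv_image_def)
  then show "P a"
    by (induction a rule: wf_induct_rule) (auto intro: step)
qed

end

lemma countable_iff_card_le_natLeq:
  includes cardinal_syntax
  shows "countable A \<longleftrightarrow> |A| \<le>o natLeq"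
proof -
  have "countable A \<longleftrightarrow> |A| \<le>o |UNIV :: nat set|"
    by (simp add: countable_def card_of_ordLeq[symmetric])
  then show ?thesis
    using card_of_nat ordLeq_ordIso_trans ordIso_symmetric by blast
qed

text \<open>
  The order type is \<open>\<omega>\<^sub>1\<close>: proper initial segments are countable, the whole type is not.
\<close>

lemma uncountable_countable_ordinal:
  includes cardinal_syntax
  shows "uncountable (UNIV :: countable_ordinal set)"
proof
  assume "countable (UNIV :: countable_ordinal set)"
  then have "countable (range Rep_ord)" by blast
  then have "countable (Field (cardSuc natLeq))"
    by (metis type_definition.Rep_range type_definition_countable_ordinal)
  then have "|Field (cardSuc natLeq)| \<le>o natLeq"
    by (simp add: countable_iff_card_le_natLeq)
  moreover have "|Field (cardSuc natLeq)| =o cardSuc natLeq"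
    by (simp add: card_of_Field_ordIso cardSuc_Card_order natLeq_Card_order)
  ultimately have "cardSuc natLeq \<le>o natLeq"
    using ordIso_ordLeq_trans ordIso_symmetric by blast
  then show False
    using cardSuc_greater[OF natLeq_Card_order] not_ordLess_ordLeq by blast
qed

lemma countable_lessThan_countable_ordinal:
  includes cardinal_syntax
  shows "countable {..<(a :: countable_ordinal)}"
proof -
  have C: "Card_order (cardSuc natLeq)"
    by (simp add: cardSuc_Card_order natLeq_Card_order)
  have "|underS (cardSuc natLeq) (Rep_ord a)| <o cardSuc natLeq"
    by (rule card_of_underS[OF C Rep_ord])
  then have "|underS (cardSuc natLeq) (Rep_ord a)| \<le>o natLeq"
    using cardSuc_ordLeq_ordLess[OF natLeq_Card_order card_of_Card_order] by blast
  then have "countable (underS (cardSuc natLeq) (Rep_ord a))"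
    by (simp add: countable_iff_card_le_natLeq)
  moreover have "Rep_ord ` {..<a} \<subseteq> underS (cardSuc natLeq) (Rep_ord a)"
    by (auto simp: underS_def less_le less_eq_countable_ordinal_def Rep_ord_inject)
  ultimately have "countable (Rep_ord ` {..<a})"
    using countable_subset by blast
  then show ?thesis
    by (rule countable_image_inj_on) (simp add: inj_on_def Rep_ord_inject)
qed

instantiation countable_ordinal :: zero
begin
definition zero_countable_ordinal :: countable_ordinal
  where "(0 :: countable_ordinal) = (LEAST a. True)"
instance ..
end

definition osuc :: "countable_ordinal \<Rightarrow> countable_ordinal"
  where "osuc a = (LEAST b. a < b)"

definition is_limit :: "countable_ordinal \<Rightarrow> bool"
  where "is_limit a \<longleftrightarrow> a \<noteq> 0 \<and> (\<forall>b. a \<noteq> osuc b)"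

lemma zero_le_countable_ordinal: "0 \<le> (a :: countable_ordinal)"
  unfolding zero_countable_ordinal_def by (simp add: Least_le)

lemma ex_greater_countable_ordinal: "\<exists>b. (a :: countable_ordinal) < b"
proof (rule ccontr)
  assume "\<nexists>b. a < b"
  then have "UNIV = insert a {..<a}"
    by (auto simp: not_less le_less)
  then show False
    using uncountable_countable_ordinal countable_lessThan_countable_ordinal[of a]
    by (metis countable_insert)
qed

lemma less_osuc: "a < osuc a"
  unfolding osuc_def using ex_greater_countable_ordinal by (rule LeastI_ex)

lemma less_osuc_iff: "b < osuc a \<longleftrightarrow> b \<le> a"
proof
  show "b < osuc a \<Longrightarrow> b \<le> a"
    unfolding osuc_def using not_less_Least by (metis not_le)
  show "b \<le> a \<Longrightarrow> b < osuc a"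
    using less_osuc by (metis le_less_trans)
qed

lemma osuc_neq_0: "osuc a \<noteq> 0"
  using less_osuc[of a] zero_le_countable_ordinal[of a] by auto

lemma osuc_inject: "osuc a = osuc b \<longleftrightarrow> a = b"
  by (metis less_osuc_iff order.antisym order.refl)


section \<open>Schreier families\<close>

text \<open>
  \<open>\<nat> = {1,2,\<dots>}\<close> is \<open>{1..} :: nat set\<close>.  The argument \<open>lam\<close> holds the approximating sequences
  \<open>\<lambda>(\<alpha>,i)\<close>, used only at limit ordinals \<open>\<alpha>\<close> and indices \<open>i \<ge> 1\<close>.  Since the recursion at a limit
  ordinal is through \<open>\<lambda>(\<alpha>,m) + 1\<close>, which lies below \<open>\<alpha>\<close> only for a proper choice of \<open>lam\<close>, the
  families are introduced inductively; the recursion equations are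
  \<open>schreier_0\<close>, \<open>schreier_osuc\<close> and \<open>schreier_limit\<close> below.
\<close>

inductive schreier_set ::
    "(countable_ordinal \<Rightarrow> nat \<Rightarrow> countable_ordinal) \<Rightarrow> countable_ordinal \<Rightarrow> nat set \<Rightarrow> bool"
  for lam
where
  zero_empty: "schreier_set lam 0 {}"
| zero_singleton: "1 \<le> n \<Longrightarrow> schreier_set lam 0 {n}"
| suc_empty: "schreier_set lam (osuc b) {}"
| suc_Union:
    "\<lbrakk>1 \<le> k;
      \<And>i. i \<in> {1..k} \<Longrightarrow> E i \<noteq> {};
      \<And>i. i \<in> {1..k} \<Longrightarrow> schreier_set lam b (E i);
      \<forall>x\<in>E 1. k \<le> x;
      \<forall>i\<in>{1..<k}. \<forall>x\<in>E i. \<forall>y\<in>E (Suc i). x < y\<rbrakk>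
     \<Longrightarrow> schreier_set lam (osuc b) (\<Union>i\<in>{1..k}. E i)"
| limit:
    "\<lbrakk>is_limit a; 1 \<le> m; \<forall>x\<in>E. m \<le> x; schreier_set lam (osuc (lam a m)) E\<rbrakk>
     \<Longrightarrow> schreier_set lam a E"

definition schreier ::
    "(countable_ordinal \<Rightarrow> nat \<Rightarrow> countable_ordinal) \<Rightarrow> countable_ordinal \<Rightarrow> nat set set"
  where "schreier lam a = {E. schreier_set lam a E}"

lemma schreier_0: "schreier lam 0 = {{}} \<union> {{n} | n. 1 \<le> n}"
proof (intro equalityI subsetI)
  fix A assume "A \<in> schreier lam 0"
  then have "schreier_set lam 0 A" by (simp add: schreier_def)
  then show "A \<in> {{}} \<union> {{n} | n. 1 \<le> n}"
    by cases (auto simp: is_limit_def osuc_neq_0[symmetric])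
next
  fix A :: "nat set" assume "A \<in> {{}} \<union> {{n} | n. 1 \<le> n}"
  then show "A \<in> schreier lam 0"
    unfolding schreier_def by (auto intro: zero_empty zero_singleton[simplified])
qed

lemma schreier_osuc:
  "schreier lam (osuc b) = {{}} \<union>
     {\<Union>i\<in>{1..k}. E i | k E. 1 \<le> k \<and> (\<forall>i\<in>{1..k}. E i \<noteq> {} \<and> E i \<in> schreier lam b) \<and>
        (\<forall>x\<in>E 1. k \<le> x) \<and> (\<forall>i\<in>{1..<k}. \<forall>x\<in>E i. \<forall>y\<in>E (Suc i). x < y)}"
  (is "_ = ?R")
proof (intro equalityI subsetI)
  fix A assume "A \<in> schreier lam (osuc b)"
  then have "schreier_set lam (osuc b) A" by (simp add: schreier_def)
  then show "A \<in> ?R"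
  proof cases
    case (suc_Union k E b')
    then have "A = (\<Union>i\<in>{1..k}. E i) \<and> 1 \<le> k \<and>
        (\<forall>i\<in>{1..k}. E i \<noteq> {} \<and> E i \<in> schreier lam b) \<and>
        (\<forall>x\<in>E 1. k \<le> x) \<and> (\<forall>i\<in>{1..<k}. \<forall>x\<in>E i. \<forall>y\<in>E (Suc i). x < y)"
      unfolding schreier_def osuc_inject by simp
    then show ?thesis by (intro UnI2 CollectI exI[of _ k] exI[of _ E])
  next
    case zero_empty
    then show ?thesis by simp
  next
    case zero_singleton
    then show ?thesis by (simp add: osuc_neq_0)
  next
    case suc_empty
    then show ?thesis by simp
  next
    case limit
    then show ?thesis unfolding is_limit_def by blast
  qed
next
  fix A assume "A \<in> ?R"
  then have "schreier_set lam (osuc b) A"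
  proof (elim UnE CollectE exE conjE)
    fix k E
    assume "A = (\<Union>i\<in>{1..k}. E i)" "1 \<le> k" "\<forall>x\<in>E 1. k \<le> x"
      "\<forall>i\<in>{1..k}. E i \<noteq> {} \<and> E i \<in> schreier lam b"
      "\<forall>i\<in>{1..<k}. \<forall>x\<in>E i. \<forall>y\<in>E (Suc i). x < y"
    then show ?thesis
      using suc_Union[of k E lam b] by (simp add: schreier_def)
  qed (simp add: suc_empty)
  then show "A \<in> schreier lam (osuc b)"
    by (simp add: schreier_def)
qed

lemma schreier_limit:
  assumes "is_limit a"
  shows "schreier lam a = {E. \<exists>m\<ge>1. (\<forall>x\<in>E. m \<le> x) \<and> E \<in> schreier lam (osuc (lam a m))}"
proof (intro equalityI subsetI)
  fix A assume "A \<in> schreier lam a"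
  then have "schreier_set lam a A" by (simp add: schreier_def)
  then show "A \<in> {E. \<exists>m\<ge>1. (\<forall>x\<in>E. m \<le> x) \<and> E \<in> schreier lam (osuc (lam a m))}"
  proof cases
    case (limit m)
    then show ?thesis unfolding schreier_def by blast
  qed (use assms in \<open>auto simp: is_limit_def\<close>)
next
  fix A assume "A \<in> {E. \<exists>m\<ge>1. (\<forall>x\<in>E. m \<le> x) \<and> E \<in> schreier lam (osuc (lam a m))}"
  then show "A \<in> schreier lam a"
    unfolding schreier_def using schreier_set.limit[OF assms] by blast
qed

lemma schreier_finite: "E \<in> schreier lam a \<Longrightarrow> finite E \<and> E \<subseteq> {1..}"
  unfolding schreier_def mem_Collect_eq
proof (induction rule: schreier_set.induct)
  case (suc_Union k E b)
  then show ?case by (intro conjI finite_UN_I UN_least) auto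
qed auto

text \<open>
  The admissible choices: at each limit ordinal, a strictly increasing sequence of successor ordinals
  with supremum \<open>\<alpha>\<close> along which the Schreier families increase.
\<close>

definition schreier_choice :: "(countable_ordinal \<Rightarrow> nat \<Rightarrow> countable_ordinal) \<Rightarrow> bool"
  where "schreier_choice lam \<longleftrightarrow>
    (\<forall>a. is_limit a \<longrightarrow>
      (\<forall>i\<ge>1. (\<exists>b. lam a i = osuc b) \<and> lam a i < a \<and> lam a i < lam a (Suc i) \<and>
             schreier lam (lam a i) \<subseteq> schreier lam (lam a (Suc i))) \<and>
      (\<forall>b<a. \<exists>i\<ge>1. b < lam a i))"


section \<open>Banach spaces and Schauder bases\<close>

text \<open>
  Banach spaces have to be quantified over inside a formula, so the space is a set \<open>V\<close>, a linear
  subspace of some ambient vector space type over the scalars \<open>'f\<close> (real or complex in the end), with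
  a norm \<open>nrm\<close> whose values matter on \<open>V\<close> only.  The ambient type carries no topology.
\<close>

locale normed_space_on = vector_space scale
  for scale :: "'f::real_normed_field \<Rightarrow> 'v::ab_group_add \<Rightarrow> 'v" +
  fixes V :: "'v set" and nrm :: "'v \<Rightarrow> real"
  assumes subspace: "subspace V"
    and nrm_eq_0_iff: "x \<in> V \<Longrightarrow> nrm x = 0 \<longleftrightarrow> x = 0"
    and nrm_triangle: "x \<in> V \<Longrightarrow> y \<in> V \<Longrightarrow> nrm (x + y) \<le> nrm x + nrm y"
    and nrm_scale: "x \<in> V \<Longrightarrow> nrm (scale c x) = norm c * nrm x"

locale banach_space_on = normed_space_on +
  assumes complete:
    "\<lbrakk>\<And>n. u n \<in> V; \<forall>\<epsilon>>0. \<exists>M. \<forall>m\<ge>M. \<forall>n\<ge>M. nrm (u m - u n) < \<epsilon>\<rbrakk>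
     \<Longrightarrow> \<exists>l\<in>V. (\<lambda>n. nrm (u n - l)) \<longlonglongrightarrow> 0"

lemma (in normed_space_on) nrm_nonneg:
  assumes "x \<in> V" shows "0 \<le> nrm x"
proof -
  have m: "scale (-1) x \<in> V"
    using assms subspace subspace_scale by blast
  have "nrm (x + scale (-1) x) \<le> nrm x + nrm (scale (-1) x)"
    using nrm_triangle[OF assms m] .
  moreover have "nrm (x + scale (-1) x) = 0"
    using nrm_eq_0_iff subspace subspace_0 by (simp add: scale_minus_left)
  ultimately show ?thesis
    using nrm_scale[OF assms, of "-1"] by simp
qed

text \<open>
  The sequence \<open>e\<close> is indexed by \<open>{1..}\<close>; the value \<open>e 0\<close> is irrelevant, and coefficient sequences
  are normalised by \<open>a 0 = 0\<close> so that their uniqueness refers to the indices \<open>i \<ge> 1\<close> only.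
\<close>

locale indexed_sequence =
  fixes scale :: "'f::real_normed_field \<Rightarrow> 'v::ab_group_add \<Rightarrow> 'v"
    and V :: "'v set" and nrm :: "'v \<Rightarrow> real" and e :: "nat \<Rightarrow> 'v"
begin

definition expansion :: "'v \<Rightarrow> (nat \<Rightarrow> 'f) \<Rightarrow> bool"
  where "expansion x a \<longleftrightarrow>
    a 0 = 0 \<and> (\<lambda>n. nrm (x - (\<Sum>i=1..n. scale (a i) (e i)))) \<longlonglongrightarrow> 0"

definition coeff :: "'v \<Rightarrow> nat \<Rightarrow> 'f"
  where "coeff x = (THE a. expansion x a)"

definition proj :: "nat set \<Rightarrow> 'v \<Rightarrow> 'v"
  where "proj A x = (\<Sum>i\<in>A. scale (coeff x i) (e i))"

definition one :: "nat set \<Rightarrow> 'v"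
  where "one A = (\<Sum>i\<in>A. e i)"

definition semi_normalized :: bool
  where "semi_normalized \<longleftrightarrow>
    0 < (INF i\<in>{1..}. nrm (e i)) \<and> bdd_above ((\<lambda>i. nrm (e i)) ` {1..})"

definition greedy_set :: "nat \<Rightarrow> 'v \<Rightarrow> nat set \<Rightarrow> bool"
  where "greedy_set m x L \<longleftrightarrow> L \<subseteq> {1..} \<and> finite L \<and> card L = m \<and>
    (\<forall>i\<in>L. \<forall>j\<in>{1..} - L. norm (coeff x j) \<le> norm (coeff x i))"

text \<open>Greedy sets are not unique; convergence is required for every choice of them.\<close>

definition quasi_greedy :: bool
  where "quasi_greedy \<longleftrightarrow>
    (\<forall>x\<in>V. \<forall>L. (\<forall>m. greedy_set m x (L m)) \<longrightarrow> (\<lambda>m. nrm (x - proj (L m) x)) \<longlonglongrightarrow> 0)"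

definition unconditional_for :: "nat set set \<Rightarrow> bool"
  where "unconditional_for F \<longleftrightarrow> (\<exists>C>0. \<forall>x\<in>V. \<forall>A\<in>F. nrm (proj A x) \<le> C * nrm x)"

definition democratic_for :: "nat set set \<Rightarrow> bool"
  where "democratic_for F \<longleftrightarrow>
    (\<exists>C>0. \<forall>A\<in>F. \<forall>B. B \<subseteq> {1..} \<and> finite B \<and> card A \<le> card B \<longrightarrow> nrm (one A) \<le> C * nrm (one B))"

end

text \<open>
  Linearity of the coefficient functionals follows from uniqueness of expansions, so \<open>coeff_bounded\<close>
  expresses that they belong to the dual space.
\<close>

locale schauder_basis = banach_space_on scale V nrm + indexed_sequence scale V nrm e
  for scale :: "'f::real_normed_field \<Rightarrow> 'v::ab_group_add \<Rightarrow> 'v" and V nrm e +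
  assumes basis_in_space: "1 \<le> i \<Longrightarrow> e i \<in> V"
    and unique_expansion: "x \<in> V \<Longrightarrow> \<exists>!a. expansion x a"
    and coeff_bounded: "1 \<le> i \<Longrightarrow> \<exists>K. \<forall>x\<in>V. norm (coeff x i) \<le> K * nrm x"
    and semi_normalized: semi_normalized

definition quasi_greedy_basis_of_type ::
    "(countable_ordinal \<Rightarrow> nat \<Rightarrow> countable_ordinal) \<Rightarrow> countable_ordinal \<Rightarrow> countable_ordinal \<Rightarrow>
     ('f::real_normed_field \<Rightarrow> 'v::ab_group_add \<Rightarrow> 'v) \<Rightarrow> 'v set \<Rightarrow> ('v \<Rightarrow> real) \<Rightarrow> (nat \<Rightarrow> 'v) \<Rightarrow> bool"
  where "quasi_greedy_basis_of_type lam \<alpha> \<beta> scl V nrm e \<longleftrightarrow>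
    schauder_basis scl V nrm e \<and>
    indexed_sequence.quasi_greedy scl V nrm e \<and>
    indexed_sequence.unconditional_for scl V nrm e (schreier lam \<alpha>) \<and>
    \<not> indexed_sequence.unconditional_for scl V nrm e (schreier lam (osuc \<alpha>)) \<and>
    indexed_sequence.democratic_for nrm e (schreier lam \<beta>) \<and>
    \<not> indexed_sequence.democratic_for nrm e (schreier lam (osuc \<beta>))"

text \<open>
  The ambient space for the existence statement: all scalar sequences with pointwise operations
  (addition comes from \<open>Function_Algebras\<close>).
\<close>

definition seq_scale :: "'f::real_normed_field \<Rightarrow> (nat \<Rightarrow> 'f) \<Rightarrow> (nat \<Rightarrow> 'f)"
  where "seq_scale c x = (\<lambda>i. c * x i)"

lemma vector_space_seq_scale: "vector_space seq_scale"
  by unfold_locales (auto simp: seq_scale_def fun_eq_iff algebra_simps)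

end

theory Submission
  imports Defs
begin

text \<open>
  The norm of a sequence \<open>x\<close> is a supremum of three kinds of seminorms: a symmetric part
  \<open>(j + 1) / N\<^sub>j\<close> times the \<open>\<ell>\<^sub>1\<close>-norm of \<open>x\<close> on a set of at most \<open>N\<^sub>j\<close> indices, the conditional part
  \<open>\<bar>w\<^sub>1 x\<^sub>1 + \<dots> + w\<^sub>n x\<^sub>n\<bar>\<close>, and weighted \<open>\<ell>\<^sub>1\<close>-norms on finite sets \<open>G\<^sub>m \<in> S\<^bsub>\<beta>+1\<^esub>\<close>.

  The weights \<open>w\<close> form averages on successive sets \<open>E\<^sub>0 < E\<^sub>1 < \<dots>\<close> with \<open>w \<le> 1 / N\<^sub>j\<close> on \<open>E\<^sub>j\<close>, chosen
  so that members of \<open>S\<^sub>\<alpha>\<close> have \<open>w\<close>-mass at most 2 while long unions of the \<open>E\<^sub>j\<close> belong to \<open>S\<^bsub>\<alpha>+1\<^esub>\<close>.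
  Hence a projection onto a member of \<open>S\<^sub>\<alpha>\<close> is controlled by the sup-norm, whereas for suitable signs
  the vector \<open>\<plusminus> 1 / (j + 1)\<close> on \<open>E\<^sub>j\<close> is bounded and its positive part is as large as a harmonic sum.
  The basis is quasi-greedy as in the Konyagin-Temlyakov argument: for a threshold \<open>t\<close> and
  \<open>J = \<lfloor>\<parallel>x\<parallel> / t\<rfloor>\<close>, the coefficients below \<open>t\<close> on \<open>E\<^sub>j\<close>, \<open>j < J\<close>, contribute at most \<open>J t \<le> \<parallel>x\<parallel>\<close>, and
  the at most \<open>N\<^sub>J\<close> coefficients above \<open>t\<close> on the other \<open>E\<^sub>j\<close> are controlled by the symmetric part.
  All indicator vectors of the same size have comparable symmetric and conditional parts, and \<open>N\<close> grows
  so fast that the symmetric norm of \<open>|G\<^sub>m|\<close> unit vectors is of order \<open>m\<close>, while \<open>G\<^sub>m\<close> has mass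
  \<open>(m + 1)\<^sup>2\<close> and members of \<open>S\<^sub>\<beta>\<close> have mass at most 1 in it.
\<close>

section \<open>Schreier families\<close>

text \<open>Blocks may be empty here, so a subset keeps the same number of blocks. Each block is
  compared with everything after it and not only with its neighbour. Both make recursion on
  \<open>k\<close> easy.\<close>

primrec consecutive_blocks :: "nat set set \<Rightarrow> nat \<Rightarrow> nat set \<Rightarrow> bool" where
  "consecutive_blocks F 0 A \<longleftrightarrow> A = {}"
| "consecutive_blocks F (Suc k) A \<longleftrightarrow>
     (\<exists>B\<in>F. \<exists>C. A = B \<union> C \<and> consecutive_blocks F k C \<and> (\<forall>x\<in>B. \<forall>y\<in>C. x < y))"

lemma consecutive_blocks_UN:
  assumes "\<And>i. i < k \<Longrightarrow> E i \<in> F"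
    and "\<And>i j x y. i < j \<Longrightarrow> j < k \<Longrightarrow> x \<in> E i \<Longrightarrow> y \<in> E j \<Longrightarrow> x < y"
  shows "consecutive_blocks F k (\<Union>i<k. E i)"
  using assms
proof (induction k arbitrary: E)
  case (Suc k)
  have "consecutive_blocks F k (\<Union>i<k. E (Suc i))"
  proof (rule Suc.IH)
    show "E (Suc i) \<in> F" if "i < k" for i using Suc.prems(1)[of "Suc i"] that by simp
    show "x < y" if "i < j" "j < k" "x \<in> E (Suc i)" "y \<in> E (Suc j)" for i j x y
      using Suc.prems(2)[of "Suc i" "Suc j"] that by simp
  qed
  moreover have "E 0 \<in> F" using Suc.prems(1)[of 0] by simp
  moreover have "\<forall>x\<in>E 0. \<forall>y\<in>(\<Union>i<k. E (Suc i)). x < y"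
    using Suc.prems(2)[of 0 "Suc i" for i] by blast
  moreover have "(\<Union>i<Suc k. E i) = E 0 \<union> (\<Union>i<k. E (Suc i))"
    by (auto simp: lessThan_Suc_eq_insert_0)
  ultimately show ?case
    unfolding consecutive_blocks.simps by blast
qed simp

text \<open>Empty blocks are dropped, which can only lower their number; this recovers the nonempty
  blocks, ordered neighbour by neighbour, that the successor clause of \<open>schreier_set\<close>
  asks for.\<close>

lemma consecutive_blocks_imp_UN:
  assumes "consecutive_blocks F k A" "A \<noteq> {}"
  shows "\<exists>k' E. 1 \<le> k' \<and> k' \<le> k \<and> (\<forall>i\<in>{1..k'}. E i \<noteq> {} \<and> E i \<in> F) \<and>
    (\<forall>i\<in>{1..<k'}. \<forall>x\<in>E i. \<forall>y\<in>E (Suc i). x < y) \<and> A = (\<Union>i\<in>{1..k'}. E i)"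
  using assms
proof (induction k arbitrary: A)
  case (Suc k)
  then obtain B C where BC: "B \<in> F" "A = B \<union> C" "consecutive_blocks F k C"
      "\<forall>x\<in>B. \<forall>y\<in>C. x < y"
    by auto
  consider "B = {}" | "C = {}" "B \<noteq> {}" | "B \<noteq> {}" "C \<noteq> {}" by blast
  then show ?case
  proof cases
    case 1
    then show ?thesis using Suc.IH[OF BC(3)] BC Suc.prems by (metis le_SucI sup_bot_left)
  next
    case 2
    then show ?thesis using BC by (intro exI[of _ 1] exI[of _ "\<lambda>_. B"]) auto
  next
    case 3
    from Suc.IH[OF BC(3) 3(2)] obtain k' E where E: "1 \<le> k'" "k' \<le> k"
      "\<forall>i\<in>{1..k'}. E i \<noteq> {} \<and> E i \<in> F"
      "\<forall>i\<in>{1..<k'}. \<forall>x\<in>E i. \<forall>y\<in>E (Suc i). x < y" "C = (\<Union>i\<in>{1..k'}. E i)"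
      by blast
    \<comment> \<open>The new block takes index 1 and the blocks of \<open>C\<close> move up by
      one.\<close>
    define E' where "E' = (\<lambda>i. if i \<le> 1 then B else E (i - 1))"
    have "A = (\<Union>i\<in>{1..Suc k'}. E' i)"
    proof -
      have "{1..Suc k'} = insert 1 (Suc ` {1..k'})"
        using image_Suc_atLeastAtMost[of 1 k'] by auto
      moreover have "(\<Union>i\<in>Suc ` {1..k'}. E' i) = (\<Union>i\<in>{1..k'}. E i)"
        unfolding image_image by (intro SUP_cong) (auto simp: E'_def)
      moreover have "E' 1 = B" by (simp add: E'_def)
      ultimately show ?thesis
        using BC(2) E(5) by simp
    qed
    moreover have "\<forall>i\<in>{1..Suc k'}. E' i \<noteq> {} \<and> E' i \<in> F"
    proof
      fix i assume "i \<in> {1..Suc k'}"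
      then have "i = 1 \<or> i - 1 \<in> {1..k'} \<and> \<not> i \<le> 1" by auto
      then show "E' i \<noteq> {} \<and> E' i \<in> F"
        using E(3) BC(1) 3(1) by (auto simp: E'_def)
    qed
    moreover have "\<forall>i\<in>{1..<Suc k'}. \<forall>x\<in>E' i. \<forall>y\<in>E' (Suc i). x < y"
    proof (intro ballI)
      fix i x y assume i: "i \<in> {1..<Suc k'}" and xy: "x \<in> E' i" "y \<in> E' (Suc i)"
      show "x < y"
      proof (cases "i = 1")
        case True
        then have "y \<in> C" using xy E(1,5) by (auto simp: E'_def)
        then show ?thesis using True xy BC(4) by (auto simp: E'_def)
      next
        case False
        then have "i - 1 \<in> {1..<k'}" "x \<in> E (i - 1)" "y \<in> E (Suc (i - 1))"
          using i xy by (auto simp: E'_def)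
        then show ?thesis using E(4) by blast
      qed
    qed
    ultimately show ?thesis using E(1,2)
      by (intro exI[of _ "Suc k'"] exI[of _ E']) auto
  qed
qed simp

text \<open>This form suits hereditary arguments. The bound \<open>k \<le> x\<close> can be demanded
  on all of \<open>A\<close>, since every later point exceeds a point of the first block.\<close>

lemma schreier_osuc_iff_blocks:
  "A \<in> schreier lam (osuc b) \<longleftrightarrow>
     A = {} \<or> (\<exists>k\<ge>1. (\<forall>x\<in>A. k \<le> x) \<and> consecutive_blocks (schreier lam b) k A)"
proof
  assume "A \<in> schreier lam (osuc b)"
  then consider "A = {}" | k E where "1 \<le> k" "A = (\<Union>i\<in>{1..k}. E i)"
      "\<forall>i\<in>{1..k}. E i \<noteq> {} \<and> E i \<in> schreier lam b" "\<forall>x\<in>E 1. k \<le> x"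
      "\<forall>i\<in>{1..<k}. \<forall>x\<in>E i. \<forall>y\<in>E (Suc i). x < y"
    unfolding schreier_osuc by blast
  then show "A = {} \<or> (\<exists>k\<ge>1. (\<forall>x\<in>A. k \<le> x) \<and> consecutive_blocks (schreier lam b) k A)"
  proof cases
    case (2 k E)
    \<comment> \<open>Order between neighbours extends to all pairs through a point of the block in
      between, which exists because no block is empty.\<close>
    have lt: "x < y" if "1 \<le> i" "i < j" "j \<le> k" "x \<in> E i" "y \<in> E j" for i j x y
      using that
    proof (induction j arbitrary: y)
      case (Suc j)
      show ?case
      proof (cases "i = j")
        case True
        then show ?thesis using 2(5) Suc.prems by (meson atLeastLessThan_iff less_eq_Suc_le)
      next
        case False
        then have ij: "i < j" using Suc.prems by simp
        then obtain z where z: "z \<in> E j" using 2(3) Suc.prems by fastforce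
        have "z < y" using 2(5) Suc.prems ij z by (meson atLeastLessThan_iff le_trans less_imp_le less_eq_Suc_le)
        moreover have "x < z" by (rule Suc.IH) (use Suc.prems ij z in auto)
        ultimately show ?thesis by simp
      qed
    qed simp
    have A: "A = (\<Union>i<k. E (Suc i))"
      unfolding 2(2) image_Suc_lessThan[symmetric] by simp
    have "consecutive_blocks (schreier lam b) k A"
      unfolding A
    proof (rule consecutive_blocks_UN)
      show "x < y" if "i < j" "j < k" "x \<in> E (Suc i)" "y \<in> E (Suc j)" for i j x y
        using lt[of "Suc i" "Suc j"] that by simp
    qed (use 2(3) in auto)
    moreover have "k \<le> x" if "x \<in> A" for x
    proof -
      obtain i where i: "i \<in> {1..k}" "x \<in> E i" using \<open>x \<in> A\<close> 2(2) by auto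
      obtain y where y: "y \<in> E 1" using 2(1,3) by fastforce
      show ?thesis
      proof (cases "i = 1")
        case False
        then have "y < x" using lt[of 1 i y x] i y by auto
        then show ?thesis using 2(4) y by (meson le_trans less_imp_le)
      qed (use i 2(4) in auto)
    qed
    ultimately show ?thesis using 2(1) by blast
  qed simp
next
  assume "A = {} \<or> (\<exists>k\<ge>1. (\<forall>x\<in>A. k \<le> x) \<and> consecutive_blocks (schreier lam b) k A)"
  then consider "A = {}" | k where "A \<noteq> {}" "k \<ge> 1" "\<forall>x\<in>A. k \<le> x"
      "consecutive_blocks (schreier lam b) k A"
    by blast
  then show "A \<in> schreier lam (osuc b)"
  proof cases
    case 1
    then show ?thesis by (simp add: schreier_osuc)
  next
    case 2
    from consecutive_blocks_imp_UN[OF 2(4,1)] obtain k' E where E: "1 \<le> k'" "k' \<le> k"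
      "\<forall>i\<in>{1..k'}. E i \<noteq> {} \<and> E i \<in> schreier lam b"
      "\<forall>i\<in>{1..<k'}. \<forall>x\<in>E i. \<forall>y\<in>E (Suc i). x < y" "A = (\<Union>i\<in>{1..k'}. E i)"
      by blast
    have "\<forall>x\<in>E 1. k' \<le> x"
      using E(1,2,5) 2(3) by (force dest: le_trans)
    then show ?thesis
      unfolding schreier_osuc using E by blast
  qed
qed

lemma consecutive_blocks_subset:
  assumes "\<And>A B. A \<in> F \<Longrightarrow> B \<subseteq> A \<Longrightarrow> B \<in> F" "consecutive_blocks F k A" "A' \<subseteq> A"
  shows "consecutive_blocks F k A'"
  using assms(2,3)
proof (induction k arbitrary: A A')
  case (Suc k)
  then obtain B C where BC: "B \<in> F" "A = B \<union> C" "consecutive_blocks F k C"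
      "\<forall>x\<in>B. \<forall>y\<in>C. x < y"
    by auto
  have "consecutive_blocks F k (C \<inter> A')" using Suc.IH[OF BC(3)] by simp
  moreover have "B \<inter> A' \<in> F" using assms(1)[OF BC(1)] by simp
  moreover have "A' = B \<inter> A' \<union> C \<inter> A'" using BC(2) Suc.prems by blast
  ultimately show ?case using BC(4) by (auto intro!: bexI[of _ "B \<inter> A'"] exI[of _ "C \<inter> A'"])
qed simp

lemma ordinal_cases:
  fixes a :: countable_ordinal
  obtains (zero) "a = 0" | (succ) b where "a = osuc b" | (lim) "is_limit a"
  unfolding is_limit_def by blast

section \<open>Heredity and eventual monotonicity of the Schreier families\<close>

locale schreier_families =
  fixes lam :: "countable_ordinal \<Rightarrow> nat \<Rightarrow> countable_ordinal"
  assumes choice: "schreier_choice lam"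
begin

lemma osuc_less_limit:
  assumes "is_limit a" "b < a"
  shows "osuc b < a"
proof -
  have "osuc b \<le> a" using assms(2) less_osuc_iff by (metis not_less)
  then show ?thesis using assms(1) by (auto simp: is_limit_def le_less)
qed

lemma osuc_lam_less:
  assumes "is_limit a" "1 \<le> i"
  shows "osuc (lam a i) < a"
  using choice assms osuc_less_limit by (auto simp: schreier_choice_def)

lemma less_lam:
  assumes "is_limit a" "b < a"
  obtains i where "1 \<le> i" "b < lam a i"
  using choice assms unfolding schreier_choice_def by blast

lemma lam_mono:
  assumes "is_limit a" "1 \<le> i" "i \<le> j"
  shows "lam a i \<le> lam a j"
  using assms(3)
proof (induction j rule: dec_induct)
  case (step n)
  then have "lam a n < lam a (Suc n)"
    using choice assms(1,2) by (auto simp: schreier_choice_def)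
  then show ?case using step.IH by simp
qed simp

text \<open>Transfinite induction: intersecting every block with \<open>B\<close> handles
  successors, and at a limit the bound \<open>m\<close> survives passing to a subset.\<close>

lemma schreier_subset:
  "A \<in> schreier lam a \<Longrightarrow> B \<subseteq> A \<Longrightarrow> B \<in> schreier lam a"
proof (induction a arbitrary: A B rule: less_induct)
  case (less a)
  show ?case
  proof (cases a rule: ordinal_cases)
    case zero
    then show ?thesis using less.prems by (auto simp: schreier_0 subset_singleton_iff)
  next
    case (succ b)
    show ?thesis
    proof (cases "A = {}")
      case False
      then obtain k where k: "k \<ge> 1" "\<forall>x\<in>A. k \<le> x" "consecutive_blocks (schreier lam b) k A"
        using less.prems succ schreier_osuc_iff_blocks by auto
      have "consecutive_blocks (schreier lam b) k B"
        by (rule consecutive_blocks_subset[OF _ k(3) less.prems(2)])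
          (use less.IH succ less_osuc in blast)
      then show ?thesis using k less.prems succ schreier_osuc_iff_blocks by blast
    qed (use less.prems in simp)
  next
    case lim
    then obtain m where m: "m \<ge> 1" "\<forall>x\<in>A. m \<le> x" "A \<in> schreier lam (osuc (lam a m))"
      using less.prems(1) by (auto simp: schreier_limit)
    have "B \<in> schreier lam (osuc (lam a m))"
      by (rule less.IH[OF osuc_lam_less[OF lim m(1)] m(3) less.prems(2)])
    then show ?thesis
      using m less.prems(2) by (auto simp: schreier_limit[OF lim])
  qed
qed

lemma empty_in_schreier: "{} \<in> schreier lam a"
proof (induction a rule: less_induct)
  case (less a)
  show ?case
  proof (cases a rule: ordinal_cases)
    case lim
    then have "{} \<in> schreier lam (osuc (lam a 1))"
      using less osuc_lam_less by simp
    then show ?thesis using lim schreier_limit by fastforce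
  qed (auto simp: schreier_0 schreier_osuc)
qed

lemma schreier_subset_osuc: "schreier lam a \<subseteq> schreier lam (osuc a)"
proof
  fix A assume A: "A \<in> schreier lam a"
  then have "consecutive_blocks (schreier lam a) 1 A"
    by (auto intro!: bexI[of _ A])
  moreover have "\<forall>x\<in>A. 1 \<le> x" using A schreier_finite by auto
  ultimately show "A \<in> schreier lam (osuc a)"
    using schreier_osuc_iff_blocks by (metis order_refl)
qed

text \<open>Inclusion is claimed only for sets lying far out: at a limit \<open>b\<close>, family
  \<open>b\<close> is entered through some index \<open>i\<close> with \<open>a < lam b i\<close>,
  and this index must lie below the set.\<close>

lemma schreier_eventually_mono:
  "a \<le> b \<Longrightarrow> \<exists>n. \<forall>A\<in>schreier lam a. (\<forall>x\<in>A. n \<le> x) \<longrightarrow> A \<in> schreier lam b"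
proof (induction b rule: less_induct)
  case (less b)
  show ?case
  proof (cases "a = b")
    case False
    then have ab: "a < b" using less.prems by simp
    show ?thesis
    proof (cases b rule: ordinal_cases)
      case zero
      then show ?thesis using ab zero_le_countable_ordinal leD by blast
    next
      case (succ c)
      then have "a \<le> c" "c < b" using ab less_osuc by (simp_all add: less_osuc_iff)
      with less.IH[of c] obtain n
        where "\<forall>A\<in>schreier lam a. (\<forall>x\<in>A. n \<le> x) \<longrightarrow> A \<in> schreier lam c" by blast
      then show ?thesis
        using schreier_subset_osuc[of c] succ by blast
    next
      case lim
      obtain i where i: "1 \<le> i" "a < lam b i" using less_lam[OF lim ab] by blast
      then have "a \<le> osuc (lam b i)" using less_osuc by (meson le_less_trans less_imp_le less_trans)
      with less.IH[OF osuc_lam_less[OF lim i(1)]] obtain n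
        where n: "\<forall>A\<in>schreier lam a. (\<forall>x\<in>A. n \<le> x) \<longrightarrow> A \<in> schreier lam (osuc (lam b i))"
        by blast
      \<comment> \<open>\<open>n\<close> serves the induction hypothesis, and \<open>i\<close> is
        the index used in the limit clause.\<close>
      have "\<forall>A\<in>schreier lam a. (\<forall>x\<in>A. max n i \<le> x) \<longrightarrow> A \<in> schreier lam b"
        using n schreier_limit[OF lim] i(1) by auto
      then show ?thesis by blast
    qed
  qed auto
qed

lemma schreier_finitely_eventually_mono:
  assumes "finite \<Gamma>" "\<And>g. g \<in> \<Gamma> \<Longrightarrow> g \<le> b"
  shows "\<exists>n. \<forall>g\<in>\<Gamma>. \<forall>A\<in>schreier lam g. (\<forall>x\<in>A. n \<le> x) \<longrightarrow> A \<in> schreier lam b"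
  using assms
proof (induction \<Gamma> rule: finite_induct)
  case (insert g \<Gamma>)
  then obtain n where n: "\<forall>g\<in>\<Gamma>. \<forall>A\<in>schreier lam g. (\<forall>x\<in>A. n \<le> x) \<longrightarrow> A \<in> schreier lam b"
    by auto
  from schreier_eventually_mono[of g b] insert.prems obtain m
    where m: "\<forall>A\<in>schreier lam g. (\<forall>x\<in>A. m \<le> x) \<longrightarrow> A \<in> schreier lam b" by auto
  show ?case using n m by (intro exI[of _ "max n m"]) auto
qed simp

end

section \<open>Averages that are small on Schreier sets\<close>

definition probability_on :: "nat set \<Rightarrow> (nat \<Rightarrow> real) \<Rightarrow> bool" where
  "probability_on F u \<longleftrightarrow>
     finite F \<and> (\<forall>i. 0 \<le> u i) \<and> (\<forall>i. i \<notin> F \<longrightarrow> u i = 0) \<and> sum u F = 1"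

lemma probability_on_sum_le_1:
  assumes "probability_on F u" "finite A"
  shows "sum u A \<le> 1"
proof -
  have "sum u A = sum u (A \<inter> F)"
    by (rule sum.mono_neutral_right) (use assms in \<open>auto simp: probability_on_def\<close>)
  also have "\<dots> \<le> sum u F"
    by (rule sum_mono2) (use assms in \<open>auto simp: probability_on_def\<close>)
  finally show ?thesis using assms by (simp add: probability_on_def)
qed

lemma sum_consecutive_blocks_le:
  fixes u :: "nat \<Rightarrow> real"
  assumes "\<And>B. B \<in> F \<Longrightarrow> sum u B \<le> e" "finite A" "consecutive_blocks F k A"
  shows "sum u A \<le> real k * e"
  using assms(2,3)
proof (induction k arbitrary: A)
  case (Suc k)
  then obtain B C where BC: "B \<in> F" "A = B \<union> C" "consecutive_blocks F k C"
      "\<forall>x\<in>B. \<forall>y\<in>C. x < y"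
    by auto
  then have "B \<inter> C = {}" by force
  then have "sum u A = sum u B + sum u C"
    using BC Suc.prems by (simp add: sum.union_disjoint)
  also have "\<dots> \<le> e + real k * e"
    using Suc.IH[OF _ BC(3)] BC Suc.prems assms(1)[OF BC(1)] by (simp add: add_mono)
  finally show ?case by (simp add: algebra_simps)
qed simp

text \<open>Peeling off minima writes a finite set as successive singletons. This puts every set
  with at most as many elements as its minimum into the first successor family.\<close>

lemma consecutive_blocks_singletons:
  assumes "finite A" "A \<subseteq> {1..}"
  shows "consecutive_blocks (schreier lam 0) (card A) A"
  using assms
proof (induction "card A" arbitrary: A)
  case (Suc k)
  then have "A \<noteq> {}" by auto
  define m where "m = Min A"
  have m: "m \<in> A" "\<And>x. x \<in> A \<Longrightarrow> m \<le> x"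
    using Suc.prems \<open>A \<noteq> {}\<close> by (auto simp: m_def)
  have k: "k = card (A - {m})" using Suc.hyps(2) m(1) Suc.prems by simp
  have "consecutive_blocks (schreier lam 0) k (A - {m})"
    using Suc.hyps(1)[OF k] Suc.prems k by auto
  moreover have "{m} \<in> schreier lam 0" using m(1) Suc.prems by (auto simp: schreier_0)
  moreover have "A = {m} \<union> (A - {m})" using m(1) by auto
  moreover have "\<forall>x\<in>{m}. \<forall>y\<in>A - {m}. x < y" using m(2) by (auto simp: order_less_le)
  ultimately show ?case
    unfolding Suc.hyps(2)[symmetric] consecutive_blocks.simps by blast
qed simp

section \<open>Successive averages with a common mass bound\<close>

text \<open>These are the numbers \<open>N\<close> of the final norm. The second term dominates the
  total size of the earlier sets; \<open>f\<close> leaves room for a further growth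
  condition.\<close>

definition weight_denominator :: "(nat \<Rightarrow> nat) \<Rightarrow> (nat \<Rightarrow> nat set) \<Rightarrow> nat \<Rightarrow> nat" where
  "weight_denominator f E j = max (f j) ((j + 2) * (\<Sum>i<j. card (E i)))"

definition weighted_sequence ::
    "nat set set \<Rightarrow> (nat \<Rightarrow> nat) \<Rightarrow> nat set \<Rightarrow> (nat \<Rightarrow> nat set) \<Rightarrow> (nat \<Rightarrow> real) \<Rightarrow> bool" where
  "weighted_sequence S f X E w \<longleftrightarrow>
     (\<forall>j. finite (E j) \<and> E j \<noteq> {} \<and> E j \<subseteq> X) \<and>
     (\<forall>i j. i < j \<longrightarrow> (\<forall>x\<in>E i. \<forall>y\<in>E j. x < y)) \<and>
     (\<forall>i. 0 \<le> w i) \<and> (\<forall>i. i \<notin> (\<Union>j. E j) \<longrightarrow> w i = 0) \<and>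
     (\<forall>j. sum w (E j) = 1) \<and>
     (\<forall>j. \<forall>i\<in>E j. w i * real (weight_denominator f E j) \<le> 1) \<and>
     (\<forall>A\<in>S. sum w A \<le> 2)"

text \<open>The pairs \<open>(E j, u j)\<close> are chosen one after another, and \<open>w\<close>
  is \<open>u j\<close> on \<open>E j\<close>. A set in \<open>S\<close> has mass at most 1 on the
  first \<open>E j\<close> that it meets; it then has a point below the later thresholds, so the
  remaining masses are at most \<open>(1/2) ^ Suc j\<close> and add up to at most 1. The relation
  \<open>R\<close> carries extra demands, with \<open>c\<close> the number of points used
  before.\<close>

lemma weighted_sequence_exists_if_step:
  fixes R :: "nat \<Rightarrow> nat \<Rightarrow> nat set \<Rightarrow> bool"
  assumes step: "\<And>j c b. \<exists>E u. probability_on E u \<and> E \<subseteq> X \<and> (\<forall>x\<in>E. b < x) \<and>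
      (\<forall>i. u i * real (max (f j) ((j + 2) * c)) \<le> 1) \<and>
      (\<forall>A\<in>S. (\<exists>x\<in>A. x \<le> b) \<longrightarrow> sum u A \<le> (1/2) ^ Suc j) \<and> R j c E"
    and fin: "\<And>A. A \<in> S \<Longrightarrow> finite A"
  shows "\<exists>E w. weighted_sequence S f X E w \<and> (\<forall>j. R j (\<Sum>i<j. card (E i)) (E j))"
proof -
  \<comment> \<open>The sum of all elements chosen so far is a convenient upper bound for each of
    them and plays the part of \<open>b\<close>.\<close>
  define P where "P = (\<lambda>(g :: nat \<Rightarrow> nat set \<times> (nat \<Rightarrow> real)) j (E, u).
      probability_on E u \<and> E \<subseteq> X \<and> (\<forall>x\<in>E. (\<Sum>i<j. \<Sum>(fst (g i))) < x) \<and>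
      (\<forall>i. u i * real (max (f j) ((j + 2) * (\<Sum>i<j. card (fst (g i))))) \<le> 1) \<and>
      (\<forall>A\<in>S. (\<exists>x\<in>A. x \<le> (\<Sum>i<j. \<Sum>(fst (g i)))) \<longrightarrow> sum u A \<le> (1/2) ^ Suc j) \<and>
      R j (\<Sum>i<j. card (fst (g i))) E)"
  have "\<exists>g. \<forall>j. P g j (g j)"
  \<comment> \<open>The requirement at \<open>j\<close> sees only the values of \<open>g\<close>
    below \<open>j\<close>, so recursion along \<open>less_than\<close> applies.\<close>
  proof (rule dependent_wf_choice[of less_than])
    show "wf less_than" by simp
    show "P g j r = P h j r" if "\<And>z. (z, j) \<in> less_than \<Longrightarrow> g z = h z" for g h j r
    proof -
      have "(\<Sum>i<j. \<Sum>(fst (g i))) = (\<Sum>i<j. \<Sum>(fst (h i)))"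
        "(\<Sum>i<j. card (fst (g i))) = (\<Sum>i<j. card (fst (h i)))"
        using that by (auto intro!: sum.cong)
      then show ?thesis by (simp only: P_def)
    qed
    show "\<exists>r. P g j r" for g j
      using step[where j=j and b="\<Sum>i<j. \<Sum>(fst (g i))" and c="\<Sum>i<j. card (fst (g i))"]
      by (auto simp: P_def)
  qed
  then obtain g where g: "\<And>j. P g j (g j)" by blast
  define E where "E = (\<lambda>j. fst (g j))"
  define u where "u = (\<lambda>j. snd (g j))"
  define b where "b = (\<lambda>j. \<Sum>i<j. \<Sum>(E i))"
  have *: "probability_on (E j) (u j)" "E j \<subseteq> X" "\<forall>x\<in>E j. b j < x"
      "\<forall>i. u j i * real (weight_denominator f E j) \<le> 1"
      "\<forall>A\<in>S. (\<exists>x\<in>A. x \<le> b j) \<longrightarrow> sum (u j) A \<le> (1/2) ^ Suc j"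
      "R j (\<Sum>i<j. card (E i)) (E j)" for j
    using g[of j] by (simp_all add: P_def E_def u_def b_def weight_denominator_def case_prod_beta)
  have finE: "finite (E j)" and u0: "0 \<le> u j i" and uE: "i \<notin> E j \<Longrightarrow> u j i = 0"
    and usum: "sum (u j) (E j) = 1" for i j
    using *(1)[of j] by (auto simp: probability_on_def)
  have neE: "E j \<noteq> {}" for j using usum[of j] by auto
  have leb: "x \<le> b j" if "i < j" "x \<in> E i" for i j x
  proof -
    have "x \<le> \<Sum>(E i)" using that finE member_le_sum[of x "E i" "\<lambda>x. x"] by simp
    also have "\<dots> \<le> b j" unfolding b_def using that member_le_sum[of i "{..<j}" "\<lambda>i. \<Sum>(E i)"] by simp
    finally show ?thesis .
  qed
  have lt: "x < y" if "i < j" "x \<in> E i" "y \<in> E j" for i j x y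
    using leb[OF that(1,2)] *(3)[of j] that(3) by force
  have uniq: "i = j" if "x \<in> E i" "x \<in> E j" for x i j
    using lt[of i j x x] lt[of j i x x] that by (metis less_irrefl linorder_neqE_nat)
  \<comment> \<open>Outside all \<open>E j\<close> the value of \<open>lev\<close> is arbitrary, but
    there every \<open>u j\<close> vanishes.\<close>
  define lev where "lev = (\<lambda>x. LEAST j. x \<in> E j)"
  define w where "w = (\<lambda>x. u (lev x) x)"
  have lev: "lev x = j" if "x \<in> E j" for x j
    unfolding lev_def using that uniq by (metis LeastI)
  have wE: "w x = u j x" if "x \<in> E j" for x j
    using lev[OF that] by (simp add: w_def)
  have "sum w A \<le> 2" if "A \<in> S" for A
  proof -
    have finA: "finite A" using fin that by simp
    then obtain J where J: "\<And>x. x \<in> A \<Longrightarrow> lev x < J"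
      using finite_nat_set_iff_bounded[of "lev ` A"] by auto
    have "sum w A \<le> (\<Sum>x\<in>A. \<Sum>j<J. u j x)"
    proof (rule sum_mono)
      fix x assume "x \<in> A"
      show "w x \<le> (\<Sum>j<J. u j x)"
        unfolding w_def by (rule member_le_sum) (use J \<open>x \<in> A\<close> u0 in auto)
    qed
    also have "\<dots> = (\<Sum>j<J. sum (u j) A)" by (rule sum.swap)
    also have "\<dots> \<le> 2"
    proof (cases "\<exists>j. A \<inter> E j \<noteq> {}")
      case False
      then have "sum (u j) A = 0" for j
        using uE by (intro sum.neutral) blast
      then show ?thesis by simp
    next
      case True
      define j0 where "j0 = (LEAST j. A \<inter> E j \<noteq> {})"
      have j0: "A \<inter> E j0 \<noteq> {}" using True unfolding j0_def by (rule LeastI_ex)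
      have small: "sum (u j) A \<le> (1/2) ^ Suc j + (if j = j0 then 1 else 0)" for j
      proof -
        consider "j < j0" | "j = j0" | "j0 < j" by linarith
        then show ?thesis
        proof cases
          case 1
          then have "A \<inter> E j = {}" using not_less_Least unfolding j0_def by blast
          then have "sum (u j) A = 0" using uE by (intro sum.neutral) blast
          then show ?thesis using 1 by simp
        next
          case 2
          then show ?thesis using probability_on_sum_le_1[OF *(1) finA, of j]
            by (simp add: add_increasing)
        next
          case 3
          then have "\<exists>x\<in>A. x \<le> b j" using j0 leb by blast
          then show ?thesis using *(5) that 3 by auto
        qed
      qed
      have "(\<Sum>j<J. sum (u j) A) \<le> (\<Sum>j<J. (1/2) ^ Suc j + (if j = j0 then 1 else 0))"
        by (rule sum_mono) (rule small)
      also have "\<dots> = (\<Sum>j<J. (1/2 :: real) ^ Suc j) + (\<Sum>j<J. if j = j0 then 1 else 0)"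
        by (rule sum.distrib)
      also have "(\<Sum>j<J. (1/2 :: real) ^ Suc j) = 1 - (1/2) ^ J"
        by (induction J) (auto simp: field_simps)
      also have "1 - (1/2 :: real) ^ J + (\<Sum>j<J. if j = j0 then 1 else 0) \<le> 2"
        by (simp add: sum.delta' algebra_simps add_increasing2)
      finally show ?thesis .
    qed
    finally show ?thesis .
  qed
  moreover have "w x = 0" if "x \<notin> (\<Union>j. E j)" for x
    using that uE by (auto simp: w_def)
  moreover have "sum w (E j) = 1" for j
    using usum[of j] wE by simp
  moreover have "w x * real (weight_denominator f E j) \<le> 1" if "x \<in> E j" for x j
    using wE[OF that] *(4) by simp
  ultimately have "weighted_sequence S f X E w"
    unfolding weighted_sequence_def using finE neE *(2) lt u0 by (simp add: w_def)
  then show ?thesis using *(6) by blast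
qed

section \<open>Existence of averages by transfinite induction\<close>

context schreier_families
begin

text \<open>This mirrors the repeated averages of the Schreier hierarchy. A finite set of lower
  ordinals is treated at once because controlling a limit family takes several lower ones.\<close>

definition averages_exist :: "countable_ordinal \<Rightarrow> bool" where
  "averages_exist a \<longleftrightarrow> (\<forall>X \<Gamma> e b. infinite X \<longrightarrow> X \<subseteq> {1..} \<longrightarrow> finite \<Gamma> \<longrightarrow> \<Gamma> \<subseteq> {..<a} \<longrightarrow> 0 < e \<longrightarrow>
     (\<exists>F u. probability_on F u \<and> F \<subseteq> X \<and> (\<forall>x\<in>F. b < x) \<and> F \<in> schreier lam a \<and>
        (\<forall>g\<in>\<Gamma>. \<forall>A\<in>schreier lam g. sum u A \<le> e)))"

lemma averages_existE:
  assumes "averages_exist a" "infinite X" "X \<subseteq> {1..}" "finite \<Gamma>" "\<Gamma> \<subseteq> {..<a}" "0 < e"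
  obtains F u where "probability_on F u" "F \<subseteq> X" "\<forall>x\<in>F. b < x" "F \<in> schreier lam a"
    "\<forall>g\<in>\<Gamma>. \<forall>A\<in>schreier lam g. sum u A \<le> e"
proof -
  have "\<exists>F u. probability_on F u \<and> F \<subseteq> X \<and> (\<forall>x\<in>F. b < x) \<and> F \<in> schreier lam a \<and>
        (\<forall>g\<in>\<Gamma>. \<forall>A\<in>schreier lam g. sum u A \<le> e)"
    using assms(1)[unfolded averages_exist_def, rule_format, OF assms(2-6)] .
  then show ?thesis using that by auto
qed

text \<open>A set in \<open>schreier lam a\<close> with a point at most \<open>n\<close> has bounded
  complexity: for a successor it consists of at most \<open>n\<close> blocks, at a limit it lies in
  one of \<open>n\<close> lower families. Smallness on finitely many lower families therefore
  controls it.\<close>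

lemma average_small_on_early_sets:
  assumes "a \<noteq> 0" "0 < e"
  shows "\<exists>\<Gamma> e'. finite \<Gamma> \<and> \<Gamma> \<subseteq> {..<a} \<and> 0 < e' \<and>
    (\<forall>u. (\<forall>g\<in>\<Gamma>. \<forall>A\<in>schreier lam g. sum u A \<le> e') \<longrightarrow>
         (\<forall>A\<in>schreier lam a. (\<exists>x\<in>A. x \<le> n) \<longrightarrow> sum u A \<le> (e :: real)))"
proof (cases a rule: ordinal_cases)
  case (succ b)
  \<comment> \<open>There are at most \<open>n\<close> blocks of mass
    \<open>e / real (n + 1)\<close>; the added 1 keeps the denominator positive.\<close>
  have "sum u A \<le> e" if u: "\<forall>A\<in>schreier lam b. sum u A \<le> e / real (n + 1)"
    and A: "A \<in> schreier lam a" and x: "x \<in> A" "x \<le> n" for u A x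
  proof -
    obtain k where k: "\<forall>x\<in>A. k \<le> x" "consecutive_blocks (schreier lam b) k A"
      using A x succ schreier_osuc_iff_blocks by auto
    have "sum u A \<le> real k * (e / real (n + 1))"
      by (rule sum_consecutive_blocks_le[OF _ _ k(2)]) (use u schreier_finite[OF A] in auto)
    also have "\<dots> \<le> real (n + 1) * (e / real (n + 1))"
      using k(1) x assms(2) by (intro mult_right_mono) force+
    finally show ?thesis by simp
  qed
  then show ?thesis
    using assms(2) succ less_osuc by (intro exI[of _ "{b}"] exI[of _ "e / real (n + 1)"]) auto
next
  case lim
  have "sum u A \<le> e"
    if "\<forall>g\<in>(\<lambda>m. osuc (lam a m)) ` {1..n}. \<forall>A\<in>schreier lam g. sum u A \<le> e"
      "A \<in> schreier lam a" "x \<in> A" "x \<le> n" for u :: "nat \<Rightarrow> real" and A x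
  proof -
    obtain m where "m \<ge> 1" "\<forall>x\<in>A. m \<le> x" "A \<in> schreier lam (osuc (lam a m))"
      using \<open>A \<in> schreier lam a\<close> by (auto simp: schreier_limit[OF lim])
    then show ?thesis using that by fastforce
  qed
  then show ?thesis
    using assms(2) osuc_lam_less[OF lim]
    by (intro exI[of _ "(\<lambda>m. osuc (lam a m)) ` {1..n}"] exI[of _ e]) auto
qed (use assms in simp)

text \<open>For \<open>d \<noteq> 0\<close> the sets are averages in family \<open>d\<close>, and
  all points of \<open>E j\<close> are at least every \<open>r i\<close> with
  \<open>i \<le> j\<close>; so the sets with index from \<open>a\<close> to below \<open>r a\<close>
  are no more than the minimum of their union. For \<open>d = 0\<close> such sets would be
  singletons, which cannot carry small weights. Uniform weights on long sets are used instead, with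
  sizes fixed in advance, so that the size of the union can be kept at most its minimum.\<close>

lemma weighted_sequence_exists:
  assumes avg: "averages_exist d" and X: "infinite X" "X \<subseteq> {1..}"
  shows "\<exists>E w. weighted_sequence (schreier lam d) f X E w \<and>
    (\<forall>a. (\<Union>j\<in>{a..<r a}. E j) \<in> schreier lam (osuc d))"
proof (cases "d = 0")
  case False
  have "\<exists>E u. probability_on E u \<and> E \<subseteq> X \<and> (\<forall>x\<in>E. b < x) \<and>
      (\<forall>i. u i * real (max (f j) ((j + 2) * c)) \<le> 1) \<and>
      (\<forall>A\<in>schreier lam d. (\<exists>x\<in>A. x \<le> b) \<longrightarrow> sum u A \<le> (1/2) ^ Suc j) \<and>
      E \<in> schreier lam d \<and> (\<forall>x\<in>E. \<forall>i\<le>j. r i \<le> x)" for j c b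
  proof -
    define N where "N = max (f j) ((j + 2) * c)"
    have "0 < (1/2 :: real) ^ Suc j" by simp
    obtain \<Gamma> e where \<Gamma>: "finite \<Gamma>" "\<Gamma> \<subseteq> {..<d}" "0 < e"
      "\<And>u. (\<forall>g\<in>\<Gamma>. \<forall>A\<in>schreier lam g. sum u A \<le> e) \<Longrightarrow>
         (\<forall>A\<in>schreier lam d. (\<exists>x\<in>A. x \<le> b) \<longrightarrow> sum u A \<le> (1/2 :: real) ^ Suc j)"
      using average_small_on_early_sets[OF False \<open>0 < (1/2) ^ Suc j\<close>, of b]
      by (elim exE conjE) (erule that, assumption+, erule allE, erule mp)
    have "0 < d" using False zero_le_countable_ordinal[of d] by simp
    \<comment> \<open>Adding 0 to \<open>\<Gamma>\<close> makes singletons light, which bounds each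
      single weight by \<open>1 / real (N + 1)\<close>.\<close>
    have "finite (insert 0 \<Gamma>)" using \<Gamma>(1) by simp
    moreover have "insert 0 \<Gamma> \<subseteq> {..<d}" using \<Gamma>(2) \<open>0 < d\<close> by simp
    moreover have "0 < min e (1 / real (N + 1))" using \<Gamma>(3) by simp
    ultimately obtain F u where F: "probability_on F u" "F \<subseteq> X" "\<forall>x\<in>F. b + (\<Sum>i\<le>j. r i) < x"
        "F \<in> schreier lam d"
        "\<forall>g\<in>insert 0 \<Gamma>. \<forall>A\<in>schreier lam g. sum u A \<le> min e (1 / real (N + 1))"
      by (rule averages_existE[OF avg X])
    have "u i * real N \<le> 1" for i
    proof (cases "i \<in> F")
      case True
      then have "{i} \<in> schreier lam 0" using F(2) X(2) by (auto simp: schreier_0)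
      then have "u i \<le> 1 / real (N + 1)" using F(5) by fastforce
      then have "u i * real N \<le> 1 / real (N + 1) * real N" by (intro mult_right_mono) auto
      also have "\<dots> \<le> 1" by simp
      finally show ?thesis .
    qed (use F(1) in \<open>simp add: probability_on_def\<close>)
    moreover have "r i \<le> x" if "x \<in> F" "i \<le> j" for x i
      using F(3) that member_le_sum[of i "{..j}" r] by force
    ultimately show ?thesis
      using F \<Gamma>(4)[of u] unfolding N_def by (intro exI[of _ F] exI[of _ u]) auto
  qed
  then have "\<exists>E w. weighted_sequence (schreier lam d) f X E w \<and>
      (\<forall>j. E j \<in> schreier lam d \<and> (\<forall>x\<in>E j. \<forall>i\<le>j. r i \<le> x))"
    by (intro weighted_sequence_exists_if_step) (use schreier_finite in auto)
  then obtain E w where Ew: "weighted_sequence (schreier lam d) f X E w"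
      "\<And>j. E j \<in> schreier lam d" "\<And>j x i. x \<in> E j \<Longrightarrow> i \<le> j \<Longrightarrow> r i \<le> x"
    by blast
  have "(\<Union>j\<in>{a..<r a}. E j) \<in> schreier lam (osuc d)" for a
  proof (cases "a < r a")
    case True
    have eq: "(\<Union>j\<in>{a..<r a}. E j) = (\<Union>i<r a - a. E (a + i))"
    proof -
      have "{a..<r a} = (\<lambda>i. a + i) ` {..<r a - a}"
        using True by (simp add: lessThan_atLeast0)
      then show ?thesis by simp
    qed
    have "consecutive_blocks (schreier lam d) (r a - a) (\<Union>j\<in>{a..<r a}. E j)"
      unfolding eq
    proof (rule consecutive_blocks_UN)
      show "x < y" if "i < j" "x \<in> E (a + i)" "y \<in> E (a + j)" for i j x y
        using Ew(1) that unfolding weighted_sequence_def by (meson nat_add_left_cancel_less)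
    qed (rule Ew(2))
    moreover have "\<forall>x\<in>(\<Union>j\<in>{a..<r a}. E j). r a - a \<le> x"
      using Ew(3) by (force intro: le_trans[OF diff_le_self])
    ultimately show ?thesis
      using True unfolding schreier_osuc_iff_blocks
      by (intro disjI2 exI[of _ "r a - a"]) auto
  qed (simp add: empty_in_schreier)
  then show ?thesis using Ew(1) by blast
next
  case True
  \<comment> \<open>\<open>M j c\<close> is the size of the next set after \<open>c\<close> points,
    large enough for the weight condition. Then \<open>s j\<close> is the total size of the first
    \<open>j\<close> sets, known before any set is chosen.\<close>
  define M where "M = (\<lambda>j c. max 1 (max (f j) ((j + 2) * c)))"
  define s where "s = rec_nat 0 (\<lambda>j c. c + M j c)"
  have s: "s 0 = 0" "s (Suc j) = s j + M j (s j)" for j by (simp_all add: s_def)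
  have "\<exists>E u. probability_on E u \<and> E \<subseteq> X \<and> (\<forall>x\<in>E. b < x) \<and>
      (\<forall>i. u i * real (max (f j) ((j + 2) * c)) \<le> 1) \<and>
      (\<forall>A\<in>schreier lam d. (\<exists>x\<in>A. x \<le> b) \<longrightarrow> sum u A \<le> (1/2) ^ Suc j) \<and>
      card E = M j c \<and> (\<forall>x\<in>E. \<forall>i\<le>j. s (r i) \<le> x)" for j c b
  proof -
    define b' where "b' = b + (\<Sum>i\<le>j. s (r i))"
    have "infinite (X - {..b'})" using X(1) by simp
    then obtain E where E: "finite E" "card E = M j c" "E \<subseteq> X - {..b'}"
      using infinite_arbitrarily_large by blast
    have M: "M j c \<ge> 1" "max (f j) ((j + 2) * c) \<le> M j c" by (simp_all add: M_def)
    define u where "u = (\<lambda>i. if i \<in> E then 1 / real (M j c) else 0)"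
    have "probability_on E u"
      using E M by (auto simp: probability_on_def u_def)
    moreover have "u i * real (max (f j) ((j + 2) * c)) \<le> 1" for i
      using M by (simp add: u_def divide_le_eq del: of_nat_max of_nat_mult of_nat_add)
    \<comment> \<open>Nonempty members of family 0 are singletons, and a point at or below
      \<open>b\<close> lies outside \<open>E\<close>.\<close>
    moreover have "sum u A \<le> (1/2) ^ Suc j" if "A \<in> schreier lam d" "x \<in> A" "x \<le> b" for A x
    proof -
      have "A = {x}" using that True by (auto simp: schreier_0)
      moreover have "x \<notin> E" using E(3) that(3) by (auto simp: b'_def)
      ultimately show ?thesis by (simp add: u_def)
    qed
    moreover have "s (r i) \<le> x" if "x \<in> E" "i \<le> j" for x i
    proof -
      have "s (r i) \<le> (\<Sum>i\<le>j. s (r i))" using that by (intro member_le_sum) auto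
      then show ?thesis using E(3) that by (auto simp: b'_def)
    qed
    moreover have "E \<subseteq> X" "\<forall>x\<in>E. b < x" using E(3) by (auto simp: b'_def)
    ultimately show ?thesis using E(2) by blast
  qed
  then have "\<exists>E w. weighted_sequence (schreier lam d) f X E w \<and>
      (\<forall>j. card (E j) = M j (\<Sum>i<j. card (E i)) \<and> (\<forall>x\<in>E j. \<forall>i\<le>j. s (r i) \<le> x))"
    by (intro weighted_sequence_exists_if_step) (use schreier_finite in auto)
  then obtain E w where Ew: "weighted_sequence (schreier lam d) f X E w"
      "\<And>j. card (E j) = M j (\<Sum>i<j. card (E i))"
      "\<And>j x i. x \<in> E j \<Longrightarrow> i \<le> j \<Longrightarrow> s (r i) \<le> x"
    by blast
  have sE: "(\<Sum>i<j. card (E i)) = s j" for j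
  proof (induction j)
    case (Suc j)
    then show ?case using Ew(2)[of j] by (simp add: s(2))
  qed (simp add: s(1))
  have "(\<Union>j\<in>{a..<r a}. E j) \<in> schreier lam (osuc d)" for a
  proof -
    define U where "U = (\<Union>j\<in>{a..<r a}. E j)"
    have "finite (E j)" "E j \<subseteq> X" for j
      using Ew(1) by (simp_all add: weighted_sequence_def)
    then have U: "finite U" "U \<subseteq> {1..}"
      using X(2) unfolding U_def by (simp, blast)
    have "card U \<le> (\<Sum>j\<in>{a..<r a}. card (E j))"
      unfolding U_def by (rule card_UN_le) simp
    also have "\<dots> \<le> (\<Sum>j<r a. card (E j))"
      by (rule sum_mono2) auto
    finally have U_le: "card U \<le> s (r a)" unfolding sE .
    have "\<forall>x\<in>U. card U \<le> x"
    proof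
      fix x assume "x \<in> U"
      then obtain j where "x \<in> E j" "a \<le> j" by (auto simp: U_def)
      then have "s (r a) \<le> x" by (rule Ew(3))
      with U_le show "card U \<le> x" by (rule le_trans)
    qed
    moreover have "consecutive_blocks (schreier lam d) (card U) U"
      using consecutive_blocks_singletons[OF U] True by simp
    ultimately have "U \<in> schreier lam (osuc d)"
      unfolding schreier_osuc_iff_blocks using U(1)
      by (metis One_nat_def Suc_leI card_gt_0_iff)
    then show ?thesis by (simp add: U_def)
  qed
  then show ?thesis using Ew(1) by blast
qed

text \<open>The mean of \<open>T\<close> successive averages for \<open>d\<close> has mass at most
  \<open>2 / real T\<close> on members of family \<open>d\<close>, and its support lies in family
  \<open>osuc d\<close>. The families in \<open>\<Gamma>\<close> are covered because far enough out
  their members belong to family \<open>d\<close>.\<close>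

lemma averages_exist_osuc:
  assumes "averages_exist d"
  shows "averages_exist (osuc d)"
  unfolding averages_exist_def
proof (intro allI impI)
  fix X :: "nat set" and \<Gamma> and e :: real and b :: nat
  assume X: "infinite X" "X \<subseteq> {1..}" and \<Gamma>: "finite \<Gamma>" "\<Gamma> \<subseteq> {..<osuc d}" and e: "0 < e"
  have "\<And>g. g \<in> \<Gamma> \<Longrightarrow> g \<le> d" using \<Gamma>(2) less_osuc_iff by blast
  from schreier_finitely_eventually_mono[OF \<Gamma>(1) this]
  obtain n where n: "\<And>g A. g \<in> \<Gamma> \<Longrightarrow> A \<in> schreier lam g \<Longrightarrow> (\<forall>x\<in>A. n \<le> x) \<Longrightarrow> A \<in> schreier lam d"
    by blast
  obtain T :: nat where T: "2 / e < real T" using reals_Archimedean2 by blast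
  then have T0: "0 < real T" using e by (metis divide_pos_pos less_trans zero_less_numeral)
  then have T2: "2 / real T \<le> e" using e T by (simp add: field_simps)
  \<comment> \<open>Beyond \<open>n\<close> the members of families in \<open>\<Gamma>\<close> lie
    in family \<open>d\<close>; \<open>b\<close> is the bound that the support has to
    exceed.\<close>
  have "infinite (X - {..max n b})" "X - {..max n b} \<subseteq> {1..}" using X by auto
  \<comment> \<open>With \<open>r\<close> constantly \<open>T\<close>, the case \<open>a = 0\<close>
    puts the union of the first \<open>T\<close> sets into the successor family.\<close>
  from weighted_sequence_exists[OF assms this, of "\<lambda>_. 0" "\<lambda>_. T"]
  obtain E w where "weighted_sequence (schreier lam d) (\<lambda>_. 0) (X - {..max n b}) E w"
    and F: "(\<Union>j\<in>{0..<T}. E j) \<in> schreier lam (osuc d)"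
    by blast
  then have E: "\<And>j. finite (E j)" "\<And>j. E j \<subseteq> X - {..max n b}"
      "\<And>i j x y. i < j \<Longrightarrow> x \<in> E i \<Longrightarrow> y \<in> E j \<Longrightarrow> x < y"
    and w: "\<And>i. 0 \<le> w i" "\<And>j. sum w (E j) = 1" "\<And>A. A \<in> schreier lam d \<Longrightarrow> sum w A \<le> 2"
    unfolding weighted_sequence_def by blast+
  define F where "F = (\<Union>j\<in>{0..<T}. E j)"
  define u where "u = (\<lambda>i. if i \<in> F then w i / real T else 0)"
  have FX: "F \<subseteq> X - {..max n b}" "finite F" using E(1,2) by (auto simp: F_def)
  have "sum w F = (\<Sum>j\<in>{0..<T}. sum w (E j))"
    unfolding F_def
  proof (rule sum.UNION_disjoint)
    show "\<forall>i\<in>{0..<T}. \<forall>j\<in>{0..<T}. i \<noteq> j \<longrightarrow> E i \<inter> E j = {}"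
      using E(3) by (metis disjoint_iff less_irrefl linorder_neqE_nat)
  qed (use E(1) in auto)
  then have "sum u F = 1"
    using w(2) T0 by (simp add: u_def sum_divide_distrib[symmetric])
  then have "probability_on F u"
    using FX w(1) by (auto simp: probability_on_def u_def)
  moreover have "sum u A \<le> e" if g: "g \<in> \<Gamma>" and A: "A \<in> schreier lam g" for g A
  proof -
    have "sum u A = sum u (A \<inter> F)"
      by (rule sum.mono_neutral_right) (use schreier_finite[OF A] in \<open>auto simp: u_def\<close>)
    also have "\<dots> = sum w (A \<inter> F) / real T"
      by (simp add: u_def sum_divide_distrib)
    also have "\<dots> \<le> 2 / real T"
    proof (rule divide_right_mono)
      have "A \<inter> F \<in> schreier lam g" using schreier_subset[OF A] by simp
      moreover have "\<forall>x\<in>A \<inter> F. n \<le> x" using FX(1) by auto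
      ultimately show "sum w (A \<inter> F) \<le> 2" using n[OF g] w(3) by blast
    qed (use T0 in simp)
    also have "\<dots> \<le> e" by (rule T2)
    finally show ?thesis .
  qed
  ultimately show "\<exists>F u. probability_on F u \<and> F \<subseteq> X \<and> (\<forall>x\<in>F. b < x) \<and> F \<in> schreier lam (osuc d) \<and>
        (\<forall>g\<in>\<Gamma>. \<forall>A\<in>schreier lam g. sum u A \<le> e)"
    using F FX(1) unfolding F_def[symmetric] by (intro exI[of _ F] exI[of _ u]) auto
qed

text \<open>Point masses start the induction. At a limit the finitely many ordinals in
  \<open>\<Gamma>\<close> lie below one \<open>lam a i\<close>; the average for
  \<open>osuc (lam a i)\<close>, taken beyond \<open>i\<close>, is supported in family
  \<open>a\<close>.\<close>

theorem averages_exist: "averages_exist a"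
proof (induction a rule: less_induct)
  case (less a)
  show ?case
  proof (cases a rule: ordinal_cases)
    case zero
    have "\<exists>F u. probability_on F u \<and> F \<subseteq> X \<and> (\<forall>x\<in>F. b < x) \<and> F \<in> schreier lam a"
      if "infinite X" "X \<subseteq> {1..}" for X b
    proof -
      obtain x where x: "x \<in> X" "b < x"
        using \<open>infinite X\<close> by (meson infinite_nat_iff_unbounded)
      then show ?thesis using that zero
        by (intro exI[of _ "{x}"] exI[of _ "\<lambda>i. if i = x then 1 else 0"])
          (auto simp: probability_on_def schreier_0)
    qed
    moreover have "{..<a} = {}" using zero zero_le_countable_ordinal leD by blast
    ultimately show ?thesis unfolding averages_exist_def by fastforce
  next
    case (succ b)
    then show ?thesis using averages_exist_osuc[OF less.IH] less_osuc by simp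
  next
    case lim
    show ?thesis
      unfolding averages_exist_def
    proof (intro allI impI)
      fix X :: "nat set" and \<Gamma> and e :: real and b :: nat
      assume X: "infinite X" "X \<subseteq> {1..}" and \<Gamma>: "finite \<Gamma>" "\<Gamma> \<subseteq> {..<a}" and e: "0 < e"
      have "\<exists>i\<ge>1. \<forall>g\<in>\<Gamma>. g < lam a i"
        using \<Gamma>
      proof (induction \<Gamma> rule: finite_induct)
        case (insert g \<Gamma>)
        then obtain i where i: "i \<ge> 1" "\<forall>g\<in>\<Gamma>. g < lam a i" by auto
        obtain k where k: "k \<ge> 1" "g < lam a k" using less_lam[OF lim, of g] insert.prems by auto
        show ?case
          using i k lam_mono[OF lim, of i "max i k"] lam_mono[OF lim, of k "max i k"]
          by (intro exI[of _ "max i k"]) fastforce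
      qed auto
      then obtain i where i: "i \<ge> 1" "\<And>g. g \<in> \<Gamma> \<Longrightarrow> g < lam a i" by blast
      have "\<Gamma> \<subseteq> {..<osuc (lam a i)}" using i(2) less_osuc by (auto simp: less_osuc_iff less_imp_le)
      then obtain F u where F: "probability_on F u" "F \<subseteq> X" "\<forall>x\<in>F. max b i < x"
          "F \<in> schreier lam (osuc (lam a i))" "\<forall>g\<in>\<Gamma>. \<forall>A\<in>schreier lam g. sum u A \<le> e"
        by (rule averages_existE[OF less.IH[OF osuc_lam_less[OF lim i(1)]] X \<Gamma>(1) _ e])
      have "F \<in> schreier lam a"
        using F(3,4) i(1) unfolding schreier_limit[OF lim] by force
      then show "\<exists>F u. probability_on F u \<and> F \<subseteq> X \<and> (\<forall>x\<in>F. b < x) \<and> F \<in> schreier lam a \<and>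
          (\<forall>g\<in>\<Gamma>. \<forall>A\<in>schreier lam g. sum u A \<le> e)"
        using F by (intro exI[of _ F] exI[of _ u]) auto
    qed
  qed
qed

end

section \<open>Sequence spaces normed by a family of seminorms\<close>

definition restrict_seq :: "nat set \<Rightarrow> (nat \<Rightarrow> 'f::real_normed_field) \<Rightarrow> nat \<Rightarrow> 'f" where
  "restrict_seq A x = (\<lambda>i. if i \<in> A then x i else 0)"

definition unit_seq :: "nat \<Rightarrow> nat \<Rightarrow> 'f::real_normed_field" where
  "unit_seq i = (\<lambda>k. if k = i then 1 else 0)"

lemma restrict_seq_eq_sum_units:
  assumes "finite A"
  shows "restrict_seq A x = (\<Sum>i\<in>A. seq_scale (x i) (unit_seq i))"
  using assms
proof (induction A rule: finite_induct)
  case empty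
  then show ?case by (auto simp: restrict_seq_def)
next
  case (insert a A)
  have "restrict_seq (insert a A) x = seq_scale (x a) (unit_seq a) + restrict_seq A x"
    using insert.hyps by (auto simp: restrict_seq_def seq_scale_def unit_seq_def fun_eq_iff)
  then show ?case unfolding sum.insert[OF insert.hyps] insert.IH .
qed

lemma sum_units_eq_restrict_seq:
  assumes "finite A"
  shows "(\<Sum>i\<in>A. unit_seq i) = restrict_seq A (\<lambda>_. 1)"
  unfolding restrict_seq_eq_sum_units[OF assms] by (simp add: seq_scale_def)

text \<open>Continuity is meant for pointwise convergence, as for seminorms that see finitely many
  coordinates; it yields completeness. Domination of coordinates makes the supremum a norm with
  bounded coefficient functionals, and domination of truncations makes the partial sum projections
  contractive.\<close>

locale seminorm_family =
  fixes \<Phi> :: "((nat \<Rightarrow> 'f::{real_normed_field,banach}) \<Rightarrow> real) set"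
  assumes seminorm_triangle: "p \<in> \<Phi> \<Longrightarrow> p (x + y) \<le> p x + p y"
    and seminorm_scale: "p \<in> \<Phi> \<Longrightarrow> p (seq_scale c x) = norm c * p x"
    and seminorm_continuous:
      "p \<in> \<Phi> \<Longrightarrow> (\<And>i. (\<lambda>n. u n i) \<longlonglongrightarrow> l i) \<Longrightarrow> (\<lambda>n. p (u n)) \<longlonglongrightarrow> p l"
    and coordinate_dominated: "1 \<le> i \<Longrightarrow> \<exists>p\<in>\<Phi>. \<forall>x. norm (x i) \<le> p x"
    and truncation_dominated: "p \<in> \<Phi> \<Longrightarrow> \<exists>q\<in>\<Phi>. \<forall>x. p (restrict_seq {1..n} x) \<le> q x"
    and seminorm_unit_le: "p \<in> \<Phi> \<Longrightarrow> 1 \<le> i \<Longrightarrow> p (unit_seq i) \<le> 1"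
begin

definition bounded_seq :: "(nat \<Rightarrow> 'f) \<Rightarrow> bool" where
  "bounded_seq x \<longleftrightarrow> bdd_above ((\<lambda>p. p x) ` \<Phi>)"

definition sup_norm :: "(nat \<Rightarrow> 'f) \<Rightarrow> real" where
  "sup_norm x = (SUP p\<in>\<Phi>. p x)"

text \<open>Vanishing tails make each element the limit of its truncations. The condition at 0
  removes the coordinate that belongs to no basis vector.\<close>

definition sup_space :: "(nat \<Rightarrow> 'f) set" where
  "sup_space = {x. x 0 = 0 \<and> bounded_seq x \<and>
     (\<lambda>n. sup_norm (x - restrict_seq {1..n} x)) \<longlonglongrightarrow> 0}"

lemma nonempty: "\<Phi> \<noteq> {}"
  using coordinate_dominated[of 1] by auto

lemma seminorm_zero: "p \<in> \<Phi> \<Longrightarrow> p 0 = 0"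
  using seminorm_scale[of p 0 0] by (simp add: seq_scale_def zero_fun_def)

lemma seminorm_minus: "p \<in> \<Phi> \<Longrightarrow> p (- x) = p x"
  using seminorm_scale[of p "-1" x] by (simp add: seq_scale_def fun_Compl_def)

lemma seminorm_diff: "p \<in> \<Phi> \<Longrightarrow> p (x - y) \<le> p x + p y"
  using seminorm_triangle[of p x "- y"] seminorm_minus[of p y] by simp

lemma seminorm_nonneg: "p \<in> \<Phi> \<Longrightarrow> 0 \<le> p x"
  using seminorm_diff[of p x x] seminorm_zero[of p] by simp

lemma seminorm_le_sup_norm: "bounded_seq x \<Longrightarrow> p \<in> \<Phi> \<Longrightarrow> p x \<le> sup_norm x"
  unfolding bounded_seq_def sup_norm_def by (rule cSUP_upper)

lemma sup_norm_leI: "(\<And>p. p \<in> \<Phi> \<Longrightarrow> p x \<le> B) \<Longrightarrow> sup_norm x \<le> B"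
  unfolding sup_norm_def by (rule cSUP_least[OF nonempty])

lemma bounded_seqI: "(\<And>p. p \<in> \<Phi> \<Longrightarrow> p x \<le> B) \<Longrightarrow> bounded_seq x"
  unfolding bounded_seq_def by (auto simp: bdd_above_def)

lemma sup_norm_nonneg: "bounded_seq x \<Longrightarrow> 0 \<le> sup_norm x"
  using nonempty seminorm_nonneg seminorm_le_sup_norm by (meson ex_in_conv order_trans)

lemma norm_coordinate_le: "bounded_seq x \<Longrightarrow> 1 \<le> i \<Longrightarrow> norm (x i) \<le> sup_norm x"
  using coordinate_dominated seminorm_le_sup_norm by (meson order_trans)

lemma bounded_seq_diff: "bounded_seq x \<Longrightarrow> bounded_seq y \<Longrightarrow> bounded_seq (x - y)"
  by (rule bounded_seqI[of _ "sup_norm x + sup_norm y"])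
    (meson seminorm_diff seminorm_le_sup_norm add_mono order_trans)

lemma bounded_seq_add: "bounded_seq x \<Longrightarrow> bounded_seq y \<Longrightarrow> bounded_seq (x + y)"
  by (rule bounded_seqI[of _ "sup_norm x + sup_norm y"])
    (meson seminorm_triangle seminorm_le_sup_norm add_mono order_trans)

lemma bounded_seq_scale: "bounded_seq x \<Longrightarrow> bounded_seq (seq_scale c x)"
  by (rule bounded_seqI[of _ "norm c * sup_norm x"])
    (simp add: seminorm_scale seminorm_le_sup_norm mult_left_mono)

lemma sup_norm_triangle:
  "bounded_seq x \<Longrightarrow> bounded_seq y \<Longrightarrow> sup_norm (x + y) \<le> sup_norm x + sup_norm y"
  by (rule sup_norm_leI) (meson seminorm_triangle seminorm_le_sup_norm add_mono order_trans)

lemma sup_norm_diff: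
  "bounded_seq x \<Longrightarrow> bounded_seq y \<Longrightarrow> sup_norm (x - y) \<le> sup_norm x + sup_norm y"
  by (rule sup_norm_leI) (meson seminorm_diff seminorm_le_sup_norm add_mono order_trans)

lemma sup_norm_scale:
  assumes "bounded_seq x"
  shows "sup_norm (seq_scale c x) = norm c * sup_norm x"
proof (rule antisym)
  show "sup_norm (seq_scale c x) \<le> norm c * sup_norm x"
    by (rule sup_norm_leI) (simp add: assms seminorm_scale seminorm_le_sup_norm mult_left_mono)
  show "norm c * sup_norm x \<le> sup_norm (seq_scale c x)"
  proof (cases "c = 0")
    case True
    then show ?thesis using sup_norm_nonneg[OF bounded_seq_scale[OF assms]] by simp
  next
    case False
    have "sup_norm x \<le> sup_norm (seq_scale c x) / norm c"
    proof (rule sup_norm_leI)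
      fix p assume "p \<in> \<Phi>"
      then have "norm c * p x \<le> sup_norm (seq_scale c x)"
        using seminorm_le_sup_norm[OF bounded_seq_scale[OF assms]] seminorm_scale by metis
      then show "p x \<le> sup_norm (seq_scale c x) / norm c"
        using False by (simp add: field_simps)
    qed
    then show ?thesis using False by (simp add: field_simps)
  qed
qed

lemma seminorm_sum_le:
  assumes "p \<in> \<Phi>" "finite A"
  shows "p (\<Sum>i\<in>A. f i) \<le> (\<Sum>i\<in>A. p (f i))"
  using assms(2)
proof (induction A rule: finite_induct)
  case (insert a A)
  then show ?case
    using seminorm_triangle[OF assms(1), of "f a" "\<Sum>i\<in>A. f i"]
    unfolding sum.insert[OF insert.hyps] by linarith
qed (unfold sum.empty, simp only: seminorm_zero[OF assms(1)])

lemma seminorm_restrict_le_sum: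
  assumes "p \<in> \<Phi>" "finite A" "A \<subseteq> {1..}"
  shows "p (restrict_seq A x) \<le> (\<Sum>i\<in>A. norm (x i))"
proof -
  have "p (restrict_seq A x) \<le> (\<Sum>i\<in>A. p (seq_scale (x i) (unit_seq i)))"
    unfolding restrict_seq_eq_sum_units[OF assms(2)] by (rule seminorm_sum_le[OF assms(1,2)])
  also have "\<dots> \<le> (\<Sum>i\<in>A. norm (x i))"
  proof (rule sum_mono)
    fix i assume "i \<in> A"
    then have "p (unit_seq i) \<le> 1" using assms seminorm_unit_le by auto
    then show "p (seq_scale (x i) (unit_seq i)) \<le> norm (x i)"
      using mult_left_mono[of "p (unit_seq i)" 1 "norm (x i)"] by (simp add: seminorm_scale[OF assms(1)])
  qed
  finally show ?thesis .
qed

lemma bounded_seq_restrict: "finite A \<Longrightarrow> A \<subseteq> {1..} \<Longrightarrow> bounded_seq (restrict_seq A x)"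
  using seminorm_restrict_le_sum by (rule bounded_seqI)

lemma seminorm_truncation_le:
  assumes "bounded_seq x" "p \<in> \<Phi>"
  shows "p (restrict_seq {1..n} x) \<le> sup_norm x"
  using truncation_dominated[OF assms(2)] seminorm_le_sup_norm[OF assms(1)] by (meson order_trans)

lemma sup_spaceI:
  assumes "x 0 = 0" "bounded_seq x"
    and "\<And>e. 0 < e \<Longrightarrow> \<exists>n. \<forall>m\<ge>n. \<forall>p\<in>\<Phi>. p (x - restrict_seq {1..m} x) \<le> e"
  shows "x \<in> sup_space"
proof -
  have "(\<lambda>n. sup_norm (x - restrict_seq {1..n} x)) \<longlonglongrightarrow> 0"
  proof (rule LIMSEQ_I)
    fix r :: real assume "0 < r"
    then obtain n where n: "\<And>m p. m \<ge> n \<Longrightarrow> p \<in> \<Phi> \<Longrightarrow> p (x - restrict_seq {1..m} x) \<le> r / 2"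
      using assms(3)[of "r / 2"] by auto
    show "\<exists>no. \<forall>n\<ge>no. norm (sup_norm (x - restrict_seq {1..n} x) - 0) < r"
    proof (intro exI allI impI)
      fix m assume "n \<le> m"
      then have "sup_norm (x - restrict_seq {1..m} x) \<le> r / 2"
        using n by (intro sup_norm_leI) auto
      moreover have "0 \<le> sup_norm (x - restrict_seq {1..m} x)"
        by (intro sup_norm_nonneg bounded_seq_diff assms bounded_seq_restrict) auto
      ultimately show "norm (sup_norm (x - restrict_seq {1..m} x) - 0) < r"
        using \<open>0 < r\<close> by simp
    qed
  qed
  then show ?thesis using assms by (simp add: sup_space_def)
qed

lemma sup_space_bounded: "x \<in> sup_space \<Longrightarrow> bounded_seq x"
  by (simp add: sup_space_def)

lemma sup_norm_small_tail:
  assumes "x \<in> sup_space" "0 < e"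
  obtains n where "\<And>m. m \<ge> n \<Longrightarrow> sup_norm (x - restrict_seq {1..m} x) \<le> e"
proof -
  have "(\<lambda>n. sup_norm (x - restrict_seq {1..n} x)) \<longlonglongrightarrow> 0"
    using assms(1) by (auto simp: sup_space_def)
  then obtain n where n: "\<And>m. m \<ge> n \<Longrightarrow> norm (sup_norm (x - restrict_seq {1..m} x) - 0) < e"
    using LIMSEQ_D[OF _ assms(2)] by blast
  have "sup_norm (x - restrict_seq {1..m} x) \<le> e" if "m \<ge> n" for m
    using n[OF that] by simp
  then show ?thesis by (rule that)
qed

lemma seminorm_small_tail:
  assumes "x \<in> sup_space" "0 < e"
  obtains n where "\<And>m p. m \<ge> n \<Longrightarrow> p \<in> \<Phi> \<Longrightarrow> p (x - restrict_seq {1..m} x) \<le> e"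
proof -
  obtain n where n: "\<And>m. m \<ge> n \<Longrightarrow> sup_norm (x - restrict_seq {1..m} x) \<le> e"
    by (rule sup_norm_small_tail[OF assms]) (rule that)
  have "p (x - restrict_seq {1..m} x) \<le> sup_norm (x - restrict_seq {1..m} x)"
    if "p \<in> \<Phi>" for p m
    by (intro seminorm_le_sup_norm bounded_seq_diff sup_space_bounded assms bounded_seq_restrict that)
      auto
  then show ?thesis using n that order_trans by meson
qed

lemma finite_support_in_sup_space:
  assumes "finite A" "A \<subseteq> {1..}"
  shows "restrict_seq A x \<in> sup_space"
proof (rule sup_spaceI)
  show "restrict_seq A x 0 = 0" using assms by (auto simp: restrict_seq_def)
  obtain n where n: "\<And>i. i \<in> A \<Longrightarrow> i \<le> n"
    using assms(1) finite_nat_set_iff_bounded_le by auto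
  have "restrict_seq A x - restrict_seq {1..m} (restrict_seq A x) = 0" if "m \<ge> n" for m
    using n that assms(2) by (force simp: restrict_seq_def fun_eq_iff)
  then show "\<exists>n. \<forall>m\<ge>n. \<forall>p\<in>\<Phi>. p (restrict_seq A x - restrict_seq {1..m} (restrict_seq A x)) \<le> e"
    if "0 < e" for e using that by (intro exI[of _ n]) (simp add: seminorm_zero)
qed (use assms bounded_seq_restrict in blast)

lemma restrict_seq_add: "restrict_seq A (x + y) = restrict_seq A x + restrict_seq A y"
  by (auto simp: restrict_seq_def)

lemma restrict_seq_diff: "restrict_seq A (x - y) = restrict_seq A x - restrict_seq A y"
  by (auto simp: restrict_seq_def)

lemma restrict_seq_scale: "restrict_seq A (seq_scale c x) = seq_scale c (restrict_seq A x)"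
  by (auto simp: restrict_seq_def seq_scale_def)

lemma seq_scale_diff: "seq_scale c (x - y) = seq_scale c x - seq_scale c y"
  by (auto simp: seq_scale_def algebra_simps)

lemma sup_space_add:
  assumes "x \<in> sup_space" "y \<in> sup_space"
  shows "x + y \<in> sup_space"
proof (rule sup_spaceI)
  show "bounded_seq (x + y)" using assms bounded_seq_add sup_space_bounded by blast
  fix e :: real assume "0 < e"
  then have e: "0 < e / 2" by simp
  obtain n where n: "\<And>m p. m \<ge> n \<Longrightarrow> p \<in> \<Phi> \<Longrightarrow> p (x - restrict_seq {1..m} x) \<le> e / 2"
    by (rule seminorm_small_tail[OF assms(1) e]) (rule that)
  obtain n' where n': "\<And>m p. m \<ge> n' \<Longrightarrow> p \<in> \<Phi> \<Longrightarrow> p (y - restrict_seq {1..m} y) \<le> e / 2"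
    by (rule seminorm_small_tail[OF assms(2) e]) (rule that)
  have "p (x + y - restrict_seq {1..m} (x + y)) \<le> e" if "m \<ge> max n n'" "p \<in> \<Phi>" for m p
  proof -
    have "p (x + y - restrict_seq {1..m} (x + y)) \<le>
        p (x - restrict_seq {1..m} x) + p (y - restrict_seq {1..m} y)"
      unfolding restrict_seq_add add_diff_add by (rule seminorm_triangle[OF that(2)])
    then show ?thesis using n[of m p] n'[of m p] that by simp
  qed
  then show "\<exists>n. \<forall>m\<ge>n. \<forall>p\<in>\<Phi>. p (x + y - restrict_seq {1..m} (x + y)) \<le> e" by blast
qed (use assms in \<open>simp add: sup_space_def\<close>)

lemma sup_space_scale:
  assumes "x \<in> sup_space"
  shows "seq_scale c x \<in> sup_space"
proof (rule sup_spaceI)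
  show "bounded_seq (seq_scale c x)" using assms bounded_seq_scale sup_space_bounded by blast
  fix e :: real assume "0 < e"
  then have e: "0 < e / (norm c + 1)" by (simp add: add_nonneg_pos)
  obtain n where n: "\<And>m p. m \<ge> n \<Longrightarrow> p \<in> \<Phi> \<Longrightarrow> p (x - restrict_seq {1..m} x) \<le> e / (norm c + 1)"
    by (rule seminorm_small_tail[OF assms e]) (rule that)
  have "p (seq_scale c x - restrict_seq {1..m} (seq_scale c x)) \<le> e" if "m \<ge> n" "p \<in> \<Phi>" for m p
  proof -
    have "p (seq_scale c x - restrict_seq {1..m} (seq_scale c x)) =
        norm c * p (x - restrict_seq {1..m} x)"
      using seminorm_scale[OF that(2), of c "x - restrict_seq {1..m} x"]
      by (simp only: restrict_seq_scale seq_scale_diff)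
    also have "\<dots> \<le> norm c * (e / (norm c + 1))"
      using n[OF that] by (rule mult_left_mono) simp
    also have "\<dots> \<le> (norm c + 1) * (e / (norm c + 1))"
      by (rule mult_right_mono) (use e in auto)
    also have "\<dots> = e" by (simp add: add_nonneg_eq_0_iff)
    finally show ?thesis .
  qed
  then show "\<exists>n. \<forall>m\<ge>n. \<forall>p\<in>\<Phi>. p (seq_scale c x - restrict_seq {1..m} (seq_scale c x)) \<le> e" by blast
qed (use assms in \<open>simp add: sup_space_def seq_scale_def\<close>)

lemma sup_space_diff: "x \<in> sup_space \<Longrightarrow> y \<in> sup_space \<Longrightarrow> x - y \<in> sup_space"
proof -
  have "x - y = x + seq_scale (-1) y"
    by (simp add: fun_eq_iff seq_scale_def)
  then show "x \<in> sup_space \<Longrightarrow> y \<in> sup_space \<Longrightarrow> x - y \<in> sup_space"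
    using sup_space_add sup_space_scale by metis
qed

text \<open>The candidate is the coordinatewise limit. Each seminorm is continuous along it, so the
  Cauchy estimate passes to the limit with the same bound for all seminorms.\<close>

lemma sup_space_complete:
  assumes u: "\<And>n. u n \<in> sup_space"
    and Cauchy: "\<forall>e>0. \<exists>M. \<forall>m\<ge>M. \<forall>n\<ge>M. sup_norm (u m - u n) < e"
  shows "\<exists>l\<in>sup_space. (\<lambda>n. sup_norm (u n - l)) \<longlonglongrightarrow> 0"
proof -
  have bu: "bounded_seq (u m - u n)" for m n
    using u sup_space_bounded sup_space_diff by blast
  have "\<exists>c. (\<lambda>n. u n i) \<longlonglongrightarrow> c" for i
  proof (cases "i = 0")
    case True
    then show ?thesis using u by (auto simp: sup_space_def)
  next
    case False
    have "Cauchy (\<lambda>n. u n i)"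
    proof (rule CauchyI)
      fix e :: real assume "0 < e"
      then obtain M where "\<forall>m\<ge>M. \<forall>n\<ge>M. sup_norm (u m - u n) < e" using Cauchy by blast
      moreover have "norm (u m i - u n i) \<le> sup_norm (u m - u n)" for m n
        using norm_coordinate_le[OF bu, of i m n] False by simp
      ultimately show "\<exists>M. \<forall>m\<ge>M. \<forall>n\<ge>M. norm (u m i - u n i) < e"
        using le_less_trans by blast
    qed
    then show ?thesis by (simp add: Cauchy_convergent_iff convergent_def)
  qed
  then obtain l where l: "\<And>i. (\<lambda>n. u n i) \<longlonglongrightarrow> l i" by metis
  have close: "p (u m - l) \<le> e" if "p \<in> \<Phi>" "\<forall>n\<ge>M. sup_norm (u m - u n) < e" for p m M e
  proof (rule tendsto_upperbound[OF seminorm_continuous[OF that(1)]])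
    show "(\<lambda>n. (u m - u n) i) \<longlonglongrightarrow> (u m - l) i" for i
      using tendsto_diff[OF tendsto_const[of "u m i"] l[of i]] by simp
    have "p (u m - u n) \<le> e" if "n \<ge> M" for n
      using seminorm_le_sup_norm[OF bu \<open>p \<in> \<Phi>\<close>, of m n] \<open>\<forall>n\<ge>M. _\<close> that by force
    then show "\<forall>\<^sub>F n in sequentially. p (u m - u n) \<le> e"
      by (auto simp: eventually_sequentially)
  qed simp
  have close': "\<exists>M. \<forall>m\<ge>M. \<forall>p\<in>\<Phi>. p (u m - l) \<le> e" if "0 < e" for e
    using Cauchy that close by meson
  obtain M0 where M0: "\<And>m p. m \<ge> M0 \<Longrightarrow> p \<in> \<Phi> \<Longrightarrow> p (u m - l) \<le> 1"
    using close'[of 1] by auto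
  have bl: "bounded_seq l"
    using bounded_seq_diff[OF sup_space_bounded[OF u, of M0] bounded_seqI[of "u M0 - l" 1]] M0 by simp
  have bul: "bounded_seq (u m - l)" for m
    using bounded_seq_diff[OF sup_space_bounded[OF u] bl] .
  have "l \<in> sup_space"
  proof (rule sup_spaceI)
    show "l 0 = 0"
      using l[of 0] u by (simp add: sup_space_def LIMSEQ_const_iff)
    fix e :: real assume "0 < e"
    then have e: "0 < e / 3" by simp
    obtain m where m: "\<And>p. p \<in> \<Phi> \<Longrightarrow> p (u m - l) \<le> e / 3" using close'[OF e] by blast
    obtain n where n: "\<And>k p. k \<ge> n \<Longrightarrow> p \<in> \<Phi> \<Longrightarrow> p (u m - restrict_seq {1..k} (u m)) \<le> e / 3"
      by (rule seminorm_small_tail[OF u[of m] e]) (rule that)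
    have "p (l - restrict_seq {1..k} l) \<le> e" if "k \<ge> n" "p \<in> \<Phi>" for k p
    proof -
      \<comment> \<open>The tail of \<open>l\<close> is the tail of \<open>u m\<close> minus the
        tail of \<open>u m - l\<close>; the latter costs \<open>e / 3\<close> twice, since
        truncation does not increase the norm.\<close>
      have "l - restrict_seq {1..k} l =
          (u m - restrict_seq {1..k} (u m)) - ((u m - l) - restrict_seq {1..k} (u m - l))"
        by (simp add: restrict_seq_diff)
      then have "p (l - restrict_seq {1..k} l) \<le>
          p (u m - restrict_seq {1..k} (u m)) + p ((u m - l) - restrict_seq {1..k} (u m - l))"
        using seminorm_diff[OF that(2)] by metis
      also have "\<dots> \<le> p (u m - restrict_seq {1..k} (u m)) + (p (u m - l) + p (restrict_seq {1..k} (u m - l)))"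
        using seminorm_diff[OF that(2)] by simp
      also have "p (restrict_seq {1..k} (u m - l)) \<le> e / 3"
        using seminorm_truncation_le[OF bul that(2), of k m] sup_norm_leI[of "u m - l" "e / 3"] m
        by force
      finally show ?thesis using n[OF that] m[OF that(2)] by linarith
    qed
    then show "\<exists>n. \<forall>m\<ge>n. \<forall>p\<in>\<Phi>. p (l - restrict_seq {1..m} l) \<le> e" by blast
  qed (rule bl)
  moreover have "(\<lambda>n. sup_norm (u n - l)) \<longlonglongrightarrow> 0"
  proof (rule LIMSEQ_I)
    fix r :: real assume "0 < r"
    then obtain M where "\<And>m p. m \<ge> M \<Longrightarrow> p \<in> \<Phi> \<Longrightarrow> p (u m - l) \<le> r / 2"
      using close'[of "r / 2"] by auto
    then have "sup_norm (u m - l) \<le> r / 2" if "m \<ge> M" for m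
      using that by (intro sup_norm_leI) auto
    then show "\<exists>M. \<forall>m\<ge>M. norm (sup_norm (u m - l) - 0) < r"
      using \<open>0 < r\<close> sup_norm_nonneg[OF bul] by (intro exI[of _ M]) fastforce
  qed
  ultimately show ?thesis by blast
qed

section \<open>The unit vectors as a Schauder basis\<close>

sublocale indexed_sequence seq_scale sup_space sup_norm unit_seq .

lemma unit_seq_eq_restrict: "unit_seq i = restrict_seq {i} (\<lambda>_. 1)"
  by (auto simp: unit_seq_def restrict_seq_def)

text \<open>The norm dominates every coordinate, and coordinate \<open>i\<close> of the partial sums
  is \<open>a i\<close> from \<open>n = i\<close> on, so convergence forces
  \<open>a i = x i\<close>.\<close>

lemma expansion_iff:
  assumes "x \<in> sup_space"
  shows "expansion x a \<longleftrightarrow> a = x"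
proof
  assume "a = x"
  then show "expansion x a"
    using assms by (simp add: expansion_def sup_space_def restrict_seq_eq_sum_units[symmetric])
next
  assume ex: "expansion x a"
  then have a: "a 0 = 0" "(\<lambda>n. sup_norm (x - restrict_seq {1..n} a)) \<longlonglongrightarrow> 0"
    by (simp_all add: expansion_def restrict_seq_eq_sum_units[symmetric])
  have "a i = x i" if "1 \<le> i" for i
  proof -
    have "(\<lambda>n. norm (x i - a i)) \<longlonglongrightarrow> 0"
    proof (rule tendsto_sandwich[OF _ _ tendsto_const a(2)])
      have "norm (x i - a i) \<le> sup_norm (x - restrict_seq {1..n} a)" if "n \<ge> i" for n
        using norm_coordinate_le[of "x - restrict_seq {1..n} a" i] that \<open>1 \<le> i\<close> assms
          bounded_seq_diff[OF sup_space_bounded bounded_seq_restrict, of x "{1..n}" a]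
        by (simp add: restrict_seq_def)
      then show "\<forall>\<^sub>F n in sequentially. norm (x i - a i) \<le> sup_norm (x - restrict_seq {1..n} a)"
        by (auto simp: eventually_sequentially)
    qed simp
    then show ?thesis by (simp add: LIMSEQ_const_iff)
  qed
  moreover have "a 0 = x 0" using a(1) assms by (simp add: sup_space_def)
  ultimately show "a = x" by (metis One_nat_def Suc_leI ext neq0_conv)
qed

lemma coeff_eq: "x \<in> sup_space \<Longrightarrow> coeff x = x"
  unfolding coeff_def by (rule the_equality) (simp_all add: expansion_iff)

lemma proj_eq: "x \<in> sup_space \<Longrightarrow> finite A \<Longrightarrow> proj A x = restrict_seq A x"
  by (simp add: proj_def coeff_eq restrict_seq_eq_sum_units)

lemma one_eq: "finite A \<Longrightarrow> one A = restrict_seq A (\<lambda>_. 1)"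
  by (simp add: one_def sum_units_eq_restrict_seq)

lemma schauder_basis_units: "schauder_basis seq_scale sup_space sup_norm unit_seq"
proof -
  interpret vector_space "seq_scale :: 'f \<Rightarrow> (nat \<Rightarrow> 'f) \<Rightarrow> nat \<Rightarrow> 'f"
    by (rule vector_space_seq_scale)
  have unit: "unit_seq i \<in> sup_space" if "1 \<le> i" for i
    unfolding unit_seq_eq_restrict by (rule finite_support_in_sup_space) (use that in auto)
  have unit_norm: "sup_norm (unit_seq i) = 1" if "1 \<le> i" for i
  proof (rule antisym)
    show "sup_norm (unit_seq i) \<le> 1"
      using seminorm_unit_le that by (intro sup_norm_leI) auto
    show "1 \<le> sup_norm (unit_seq i)"
      using norm_coordinate_le[OF sup_space_bounded[OF unit[OF that]] that] by (simp add: unit_seq_def)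
  qed
  show ?thesis
  proof
    show "subspace sup_space"
      unfolding subspace_def
      using sup_space_add sup_space_scale finite_support_in_sup_space[of "{}"]
      by (auto simp: restrict_seq_def zero_fun_def)
    show "sup_norm x = 0 \<longleftrightarrow> x = 0" if "x \<in> sup_space" for x
    proof
      assume 0: "sup_norm x = 0"
      have "x i = 0" for i
        using norm_coordinate_le[OF sup_space_bounded[OF that], of i] 0 that
        by (cases "i = 0") (auto simp: sup_space_def)
      then show "x = 0" by auto
    next
      assume "x = 0"
      then show "sup_norm x = 0"
        using nonempty by (simp add: sup_norm_def seminorm_zero cong: SUP_cong_simp)
    qed
    show "sup_norm (x + y) \<le> sup_norm x + sup_norm y" if "x \<in> sup_space" "y \<in> sup_space" for x y
      using that sup_space_bounded sup_norm_triangle by blast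
    show "sup_norm (seq_scale c x) = norm c * sup_norm x" if "x \<in> sup_space" for x c
      using that sup_space_bounded sup_norm_scale by blast
    show "\<exists>l\<in>sup_space. (\<lambda>n. sup_norm (u n - l)) \<longlonglongrightarrow> 0"
      if "\<And>n. u n \<in> sup_space" "\<forall>e>0. \<exists>M. \<forall>m\<ge>M. \<forall>n\<ge>M. sup_norm (u m - u n) < e" for u
      using sup_space_complete[OF that] .
    show "unit_seq i \<in> sup_space" if "1 \<le> i" for i using unit[OF that] .
    show "\<exists>!a. expansion x a" if "x \<in> sup_space" for x
      using expansion_iff[OF that] by simp
    show "\<exists>K. \<forall>x\<in>sup_space. norm (coeff x i) \<le> K * sup_norm x" if "1 \<le> i" for i
      using that norm_coordinate_le sup_space_bounded by (intro exI[of _ 1]) (simp add: coeff_eq)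
    show "semi_normalized"
      using unit_norm unfolding semi_normalized_def by (auto simp: bdd_above_def cong: INF_cong_simp image_cong_simp)
  qed
qed

section \<open>Greedy approximations\<close>

lemma sup_space_coordinates_eventually_small:
  assumes "x \<in> sup_space" "0 < e"
  shows "finite {j. 1 \<le> j \<and> e \<le> norm (x j)}"
proof -
  obtain n where n: "\<And>m. m \<ge> n \<Longrightarrow> sup_norm (x - restrict_seq {1..m} x) \<le> e / 2"
    by (rule sup_norm_small_tail[OF assms(1), of "e / 2"]) (use assms(2) in auto)
  have "norm (x j) < e" if "j > n" for j
  proof -
    have "norm ((x - restrict_seq {1..n} x) j) \<le> sup_norm (x - restrict_seq {1..n} x)"
      by (intro norm_coordinate_le bounded_seq_diff sup_space_bounded assms bounded_seq_restrict)
        (use that in auto)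
    then show ?thesis using n[of n] that assms(2) by (simp add: restrict_seq_def)
  qed
  then have "{j. 1 \<le> j \<and> e \<le> norm (x j)} \<subseteq> {..n}"
    by (force simp: not_less[symmetric])
  then show ?thesis using finite_subset by blast
qed

text \<open>Large greedy sets of \<open>x\<close> contain all indices in \<open>{1..n}\<close> with
  nonzero coefficient. The remainder of \<open>x\<close> is then the remainder of its tail
  \<open>z\<close>, for which the rest \<open>A\<close> of the greedy set is again greedy; the
  uniform bound turns the small tail into a small remainder.\<close>

lemma quasi_greedyI:
  assumes bound: "\<And>x A. x \<in> sup_space \<Longrightarrow> finite A \<Longrightarrow> A \<subseteq> {1..} \<Longrightarrow>
      \<forall>i\<in>A. \<forall>j\<in>{1..} - A. norm (x j) \<le> norm (x i) \<Longrightarrow>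
      sup_norm (restrict_seq A x) \<le> K * sup_norm x"
    and "0 \<le> K"
  shows quasi_greedy
  unfolding quasi_greedy_def
proof (intro ballI allI impI)
  fix x L assume x: "x \<in> sup_space" and "\<forall>m. greedy_set m x (L m)"
  then have L: "L m \<subseteq> {1..}" "finite (L m)" "card (L m) = m"
    "\<And>i j. i \<in> L m \<Longrightarrow> j \<in> {1..} - L m \<Longrightarrow> norm (x j) \<le> norm (x i)" for m
    by (auto simp: greedy_set_def coeff_eq)
  have main: "\<exists>M. \<forall>m\<ge>M. sup_norm (x - restrict_seq (L m) x) < e" if "0 < e" for e
  proof -
    have "0 < e / (2 * (1 + K))" using that assms(2) by simp
    then obtain n where n: "sup_norm (x - restrict_seq {1..n} x) \<le> e / (2 * (1 + K))"
      using sup_norm_small_tail[OF x] by (metis order_refl)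
    define z where "z = x - restrict_seq {1..n} x"
    have z: "z \<in> sup_space"
      unfolding z_def by (intro sup_space_diff x finite_support_in_sup_space) auto
    define I where "I = {i\<in>{1..n}. x i \<noteq> 0}"
    \<comment> \<open>Inserting 1 keeps the minimum defined and positive when \<open>I\<close> is
      empty.\<close>
    define d where "d = Min (insert 1 ((\<lambda>i. norm (x i)) ` I))"
    have "finite I" by (simp add: I_def)
    then have d: "0 < d" "\<And>i. i \<in> I \<Longrightarrow> d \<le> norm (x i)"
      unfolding d_def by (auto simp: I_def)
    \<comment> \<open>With more elements than there are coefficients of size at least
      \<open>d\<close>, a greedy set contains the index of a smaller one, hence all of
      \<open>I\<close>.\<close>
    define M where "M = Suc (card {j. 1 \<le> j \<and> d \<le> norm (x j)})"
    have "sup_norm (x - restrict_seq (L m) x) < e" if "m \<ge> M" for m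
    proof -
      have "\<not> L m \<subseteq> {j. 1 \<le> j \<and> d \<le> norm (x j)}"
        using card_mono[OF sup_space_coordinates_eventually_small[OF x d(1)], of "L m"] L(3)[of m] that
        by (auto simp: M_def)
      then obtain j where j: "j \<in> L m" "norm (x j) < d" using L(1)[of m] by force
      have I: "i \<in> L m" if "i \<in> I" for i
      proof (rule ccontr)
        assume "i \<notin> L m"
        then have "norm (x i) \<le> norm (x j)"
          using L(4)[OF j(1), of i] that by (auto simp: I_def)
        then show False using d(2)[OF that] j(2) by simp
      qed
      define A where "A = L m - {1..n}"
      have eq: "x - restrict_seq (L m) x = z - restrict_seq A z"
      proof
        fix i
        show "(x - restrict_seq (L m) x) i = (z - restrict_seq A z) i"
        proof (cases "i \<in> {1..n}")
          case True
          then have "x i = 0 \<or> i \<in> L m" using I[of i] by (auto simp: I_def)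
          then show ?thesis using True by (auto simp: z_def A_def restrict_seq_def)
        next
          case False
          then have "restrict_seq {1..n} x i = 0" by (auto simp: restrict_seq_def)
          then have "z i = x i" by (simp add: z_def)
          moreover have "i \<in> A \<longleftrightarrow> i \<in> L m" using False by (simp add: A_def)
          ultimately show ?thesis by (simp add: restrict_seq_def)
        qed
      qed
      have "norm (z j) \<le> norm (z i)" if "i \<in> A" "j \<in> {1..} - A" for i j
        using that L(4)[of i m j] by (auto simp: A_def z_def restrict_seq_def)
      then have "sup_norm (restrict_seq A z) \<le> K * sup_norm z"
        using L(1,2)[of m] by (intro bound z) (auto simp: A_def)
      moreover have "bounded_seq (restrict_seq A z)"
        using L(1,2)[of m] by (intro bounded_seq_restrict) (auto simp: A_def)
      then have "sup_norm (z - restrict_seq A z) \<le> sup_norm z + sup_norm (restrict_seq A z)"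
        using sup_norm_diff sup_space_bounded z by blast
      ultimately have "sup_norm (x - restrict_seq (L m) x) \<le> (1 + K) * sup_norm z"
        unfolding eq by (simp add: algebra_simps)
      also have "\<dots> \<le> (1 + K) * (e / (2 * (1 + K)))"
        using n assms(2) unfolding z_def by (intro mult_left_mono) auto
      also have "\<dots> < e" using assms(2) \<open>0 < e\<close> by (simp add: field_simps add_pos_nonneg)
      finally show ?thesis .
    qed
    then show ?thesis by blast
  qed
  have "0 \<le> sup_norm (x - restrict_seq (L m) x)" for m
    by (intro sup_norm_nonneg bounded_seq_diff sup_space_bounded x bounded_seq_restrict L)
  then have "(\<lambda>m. sup_norm (x - restrict_seq (L m) x)) \<longlonglongrightarrow> 0"
    using main by (intro LIMSEQ_I) simp
  then show "(\<lambda>m. sup_norm (x - proj (L m) x)) \<longlonglongrightarrow> 0"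
    using proj_eq[OF x L(2)] by simp
qed

end

section \<open>The conditional norm\<close>

text \<open>The sign is chosen against the current partial sum: subtract when it is nonnegative, add
  otherwise. Steps of size at most 1 then never leave the interval from -1 to 1.\<close>

lemma ex_signs_bounded_partial_sums:
  fixes a :: "nat \<Rightarrow> real"
  assumes "\<And>i. 0 \<le> a i" "\<And>i. a i \<le> 1"
  shows "\<exists>s. (\<forall>i. s i = 1 \<or> s i = -1) \<and> (\<forall>n. \<bar>\<Sum>i\<in>{1..n}. s i * a i\<bar> \<le> 1)"
proof -
  define S where "S = rec_nat 0 (\<lambda>n t. if 0 \<le> t then t - a (Suc n) else t + a (Suc n))"
  define s where "s = (\<lambda>n. if 0 \<le> S (n - 1) then -1 else 1 :: real)"
  have S: "S 0 = 0" "S (Suc n) = (if 0 \<le> S n then S n - a (Suc n) else S n + a (Suc n))" for n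
    by (simp_all add: S_def)
  have "(\<Sum>i\<in>{1..n}. s i * a i) = S n" for n
    by (induction n) (simp_all add: S s_def)
  moreover have "\<bar>S n\<bar> \<le> 1" for n
  proof (induction n)
    case (Suc n)
    then show ?case using assms[of "Suc n"] by (auto simp: S abs_le_iff)
  qed (simp add: S)
  ultimately show ?thesis by (intro exI[of _ s]) (simp add: s_def)
qed

text \<open>The growth of \<open>N\<close> is for comparing different levels,
  \<open>N_ge_card\<close> for bounding the vector that shows conditionality, and the pairs
  \<open>G\<close>, \<open>v\<close> for destroying democracy away from the sets \<open>E\<close>.
  The argument \<open>scalars\<close> fixes the type \<open>'f\<close>, which the other parameters
  do not mention.\<close>

locale conditional_norm =
  fixes E :: "nat \<Rightarrow> nat set" and w :: "nat \<Rightarrow> real" and N :: "nat \<Rightarrow> nat"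
    and G :: "nat \<Rightarrow> nat set" and v :: "nat \<Rightarrow> nat \<Rightarrow> real"
    and scalars :: "'f::{real_normed_field,banach} itself"
  assumes finite_E: "finite (E j)" and E_pos: "E j \<subseteq> {1..}"
    and E_less: "i < j \<Longrightarrow> x \<in> E i \<Longrightarrow> y \<in> E j \<Longrightarrow> x < y"
    and w_nonneg: "0 \<le> w i" and w_outside: "i \<notin> (\<Union>j. E j) \<Longrightarrow> w i = 0"
    and sum_w_E: "sum w (E j) = 1" and w_N_le: "i \<in> E j \<Longrightarrow> w i * real (N j) \<le> 1"
    and N_0: "N 0 = 1" and N_growth: "i < l \<Longrightarrow> (l + 1) * N i \<le> N l"
    and N_ge_card: "(l + 1) * (\<Sum>i<l. card (E i)) \<le> N l"
    and finite_G: "finite (G m)" and G_pos: "G m \<subseteq> {1..}" and E_G_disjoint: "E j \<inter> G m = {}"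
    and v_nonneg: "0 \<le> v m i" and v_le_1: "i \<in> G m \<Longrightarrow> v m i \<le> 1"
begin

definition level_seminorm :: "nat \<Rightarrow> nat set \<Rightarrow> (nat \<Rightarrow> 'f) \<Rightarrow> real" where
  "level_seminorm j A x = real (j + 1) / real (N j) * (\<Sum>i\<in>A. norm (x i))"

definition partial_sum_seminorm :: "nat \<Rightarrow> (nat \<Rightarrow> 'f) \<Rightarrow> real" where
  "partial_sum_seminorm n x = norm (\<Sum>i\<in>{1..n}. w i *\<^sub>R x i)"

definition block_seminorm :: "nat \<Rightarrow> (nat \<Rightarrow> 'f) \<Rightarrow> real" where
  "block_seminorm m x = (\<Sum>i\<in>G m. v m i * norm (x i))"

definition seminorms :: "((nat \<Rightarrow> 'f) \<Rightarrow> real) set" where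
  "seminorms = {level_seminorm j A | j A. finite A \<and> A \<subseteq> {1..} \<and> card A \<le> N j} \<union>
     range partial_sum_seminorm \<union> range block_seminorm"

lemma seminorms_cases:
  assumes "p \<in> seminorms"
  obtains (level) j A where "p = level_seminorm j A" "finite A" "A \<subseteq> {1..}" "card A \<le> N j"
    | (partial) n where "p = partial_sum_seminorm n"
    | (block) m where "p = block_seminorm m"
  using assms unfolding seminorms_def by blast

lemma level_in: "finite A \<Longrightarrow> A \<subseteq> {1..} \<Longrightarrow> card A \<le> N j \<Longrightarrow> level_seminorm j A \<in> seminorms"
  and partial_in: "partial_sum_seminorm n \<in> seminorms"
  and block_in: "block_seminorm m \<in> seminorms"
  unfolding seminorms_def by blast+

lemma N_ge: "l + 1 \<le> N l"
  using N_growth[of 0 l] N_0 by (cases "l = 0") auto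

lemma N_pos: "0 < N l"
  using N_ge[of l] by simp

lemma N_mono: "j \<le> l \<Longrightarrow> N j \<le> N l"
  using N_growth[of j l] by (cases "j = l") auto

text \<open>Weights on \<open>E l\<close> are at most \<open>1 / real (N l)\<close> and
  \<open>N\<close> is nondecreasing; indices in no set have weight 0.\<close>

lemma w_late_le:
  assumes "\<And>l. l < j \<Longrightarrow> i \<notin> E l"
  shows "w i \<le> 1 / real (N j)"
proof (cases "i \<in> (\<Union>j. E j)")
  case True
  then obtain l where l: "i \<in> E l" by blast
  then have "N j \<le> N l" using assms[of l] by (intro N_mono) (auto simp: not_less[symmetric])
  then have "w i * real (N j) \<le> w i * real (N l)" using w_nonneg by (simp add: mult_left_mono)
  also have "\<dots> \<le> 1" by (rule w_N_le[OF l])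
  finally show ?thesis using N_pos[of j] by (simp add: field_simps)
qed (simp add: w_outside)

lemma w_le_1: "w i \<le> 1"
  using w_late_le[of 0 i] N_0 by simp

lemma E_disjoint: "i \<noteq> j \<Longrightarrow> E i \<inter> E j = {}"
  by (metis E_less disjoint_iff less_irrefl linorder_neqE_nat)

lemma sum_w_UN: "finite J \<Longrightarrow> sum w (\<Union>j\<in>J. E j) = real (card J)"
  using E_disjoint by (subst sum.UNION_disjoint) (auto simp: finite_E sum_w_E)

text \<open>The first \<open>j\<close> sets have total mass \<open>j\<close>; the remaining points
  number at most \<open>N j\<close>, and each weighs at most \<open>1 / real (N j)\<close>.\<close>

lemma sum_w_le:
  assumes "finite A" "card A \<le> N j"
  shows "sum w A \<le> real (j + 1)"
proof -
  define U where "U = (\<Union>l<j. E l)"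
  have "sum w A = sum w (A \<inter> U) + sum w (A - U)"
    using assms(1) by (rule sum.Int_Diff)
  also have "sum w (A \<inter> U) \<le> sum w U"
    by (rule sum_mono2) (auto simp: U_def finite_E w_nonneg)
  also have "\<dots> = real j" unfolding U_def using sum_w_UN[of "{..<j}"] by simp
  also have "sum w (A - U) \<le> real (card (A - U)) * (1 / real (N j))"
    by (rule sum_bounded_above) (use w_late_le in \<open>auto simp: U_def\<close>)
  also have "\<dots> \<le> 1"
    using card_mono[OF assms(1), of "A - U"] assms(2) N_pos[of j] by (simp add: divide_le_eq)
  finally show ?thesis by simp
qed

lemma level_restrict_le: "finite A \<Longrightarrow> level_seminorm j A (restrict_seq B x) \<le> level_seminorm j A x"
  unfolding level_seminorm_def by (intro mult_left_mono sum_mono) (auto simp: restrict_seq_def)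

lemma block_restrict_le: "block_seminorm m (restrict_seq B x) \<le> block_seminorm m x"
  unfolding block_seminorm_def
  by (intro sum_mono mult_left_mono v_nonneg) (auto simp: restrict_seq_def)

lemma partial_restrict_le:
  assumes "finite B"
  shows "partial_sum_seminorm n (restrict_seq B x) \<le> (\<Sum>i\<in>B. w i * norm (x i))"
proof -
  have "(\<Sum>i\<in>{1..n}. w i *\<^sub>R restrict_seq B x i) = (\<Sum>i\<in>{1..n} \<inter> B. w i *\<^sub>R x i)"
    by (intro sum.mono_neutral_cong_right) (auto simp: restrict_seq_def)
  also have "norm \<dots> \<le> (\<Sum>i\<in>{1..n} \<inter> B. w i * norm (x i))"
    by (rule norm_sum[THEN order_trans]) (simp add: w_nonneg)
  also have "\<dots> \<le> (\<Sum>i\<in>B. w i * norm (x i))"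
    by (rule sum_mono2) (use assms w_nonneg in auto)
  finally show ?thesis by (simp add: partial_sum_seminorm_def)
qed

sublocale seminorm_family seminorms
proof
  fix p :: "(nat \<Rightarrow> 'f) \<Rightarrow> real" assume p: "p \<in> seminorms"
  show "p (x + y) \<le> p x + p y" for x y
    using p
  proof (cases p rule: seminorms_cases)
    case (level j A)
    have "(\<Sum>i\<in>A. norm ((x + y) i)) \<le> (\<Sum>i\<in>A. norm (x i)) + (\<Sum>i\<in>A. norm (y i))"
      unfolding sum.distrib[symmetric] by (intro sum_mono) (simp add: norm_triangle_ineq)
    then have "p (x + y) \<le> real (j + 1) / real (N j) *
        ((\<Sum>i\<in>A. norm (x i)) + (\<Sum>i\<in>A. norm (y i)))"
      unfolding level(1) level_seminorm_def by (rule mult_left_mono) simp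
    then show ?thesis by (simp add: level(1) level_seminorm_def algebra_simps)
  next
    case (partial n)
    then show ?thesis
      by (simp add: partial_sum_seminorm_def scaleR_add_right sum.distrib norm_triangle_ineq)
  next
    case (block m)
    have "v m i * norm ((x + y) i) \<le> v m i * norm (x i) + v m i * norm (y i)" for i
      unfolding distrib_left[symmetric]
      by (intro mult_left_mono v_nonneg) (simp add: norm_triangle_ineq)
    then show ?thesis
      unfolding block block_seminorm_def sum.distrib[symmetric] by (intro sum_mono)
  qed
  show "p (seq_scale c x) = norm c * p x" for c x
    using p
  proof (cases p rule: seminorms_cases)
    case (level j A)
    then show ?thesis
      by (simp add: level_seminorm_def seq_scale_def norm_mult sum_distrib_left[symmetric])
  next
    case (partial n)
    have "(\<Sum>i\<in>{1..n}. w i *\<^sub>R (c * x i)) = c * (\<Sum>i\<in>{1..n}. w i *\<^sub>R x i)"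
      by (simp add: sum_distrib_left)
    then show ?thesis by (simp only: partial partial_sum_seminorm_def seq_scale_def norm_mult)
  next
    case (block m)
    then show ?thesis
      by (simp add: block_seminorm_def seq_scale_def norm_mult sum_distrib_left mult.left_commute)
  qed
  show "(\<lambda>n. p (u n)) \<longlonglongrightarrow> p l" if "\<And>i. (\<lambda>n. u n i) \<longlonglongrightarrow> l i" for u l
    using p
  proof (cases p rule: seminorms_cases)
    case (level j A)
    show ?thesis unfolding level(1) level_seminorm_def
      by (rule tendsto_mult_left, rule tendsto_sum, rule tendsto_norm, rule that)
  next
    case (partial k)
    show ?thesis unfolding partial partial_sum_seminorm_def
      by (rule tendsto_norm, rule tendsto_sum, rule tendsto_scaleR[OF tendsto_const that])
  next
    case (block m)
    show ?thesis unfolding block block_seminorm_def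
      by (rule tendsto_sum, rule tendsto_mult_left, rule tendsto_norm, rule that)
  qed
  show "\<exists>q\<in>seminorms. \<forall>x. p (restrict_seq {1..n} x) \<le> q x" for n
    using p
  proof (cases p rule: seminorms_cases)
    case (level j A)
    then show ?thesis using p level_restrict_le by blast
  next
    case (partial k)
    have "(\<Sum>i\<in>{1..k}. w i *\<^sub>R restrict_seq {1..n} x i) = (\<Sum>i\<in>{1..min k n}. w i *\<^sub>R x i)" for x :: "nat \<Rightarrow> 'f"
      by (intro sum.mono_neutral_cong_right) (auto simp: restrict_seq_def)
    then show ?thesis
      by (intro bexI[OF _ partial_in[of "min k n"]]) (simp add: partial partial_sum_seminorm_def)
  next
    case (block m)
    then show ?thesis using p block_restrict_le by blast
  qed
  show "p (unit_seq i) \<le> 1" if "1 \<le> i" for i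
    using p
  proof (cases p rule: seminorms_cases)
    case (level j A)
    have "(\<Sum>k\<in>A. norm (unit_seq i k :: 'f)) \<le> 1"
      using level(2) by (simp add: unit_seq_def if_distrib[of norm] sum.delta' cong: if_cong)
    then have "p (unit_seq i) \<le> real (j + 1) / real (N j) * 1"
      unfolding level(1) level_seminorm_def by (rule mult_left_mono) simp
    also have "\<dots> \<le> 1" using N_ge[of j] N_pos[of j] by (simp add: divide_le_eq)
    finally show ?thesis .
  next
    case (partial n)
    have "unit_seq i = (restrict_seq {i} (\<lambda>_. 1) :: nat \<Rightarrow> 'f)"
      by (auto simp: unit_seq_def restrict_seq_def)
    then show ?thesis
      using partial_restrict_le[of "{i}" n "\<lambda>_. 1"] w_le_1[of i] by (simp add: partial)
  next
    case (block m)
    have "(\<Sum>k\<in>G m. v m k * norm (unit_seq i k :: 'f)) = (\<Sum>k\<in>G m. if k = i then v m k else 0)"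
      by (intro sum.cong) (auto simp: unit_seq_def)
    also have "\<dots> \<le> 1" using finite_G v_le_1 by (simp add: sum.delta)
    finally show ?thesis by (simp add: block block_seminorm_def)
  qed
next
  fix i :: nat assume "1 \<le> i"
  \<comment> \<open>At level 0 the factor is 1 because \<open>N 0 = 1\<close>, so singletons give
    the moduli of the coordinates.\<close>
  then have "level_seminorm 0 {i} \<in> seminorms" by (intro level_in) (auto simp: N_0)
  moreover have "level_seminorm 0 {i} x = norm (x i)" for x
    by (simp add: level_seminorm_def N_0)
  ultimately show "\<exists>p\<in>seminorms. \<forall>x. norm (x i) \<le> p x" by (metis order_refl)
qed

section \<open>Quasi-greediness\<close>

text \<open>Level and block seminorms shrink under restriction. For partial sums, the indices of
  \<open>A\<close> of level below \<open>J\<close> are all indices of such level minus those outside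
  \<open>A\<close>, and the other indices of \<open>A\<close> are treated separately; each of the
  three sums is at most \<open>c\<close>.\<close>

lemma greedy_projection_bound:
  assumes x: "x \<in> sup_space" and A: "finite A" "A \<subseteq> {1..}"
    and greedy: "\<forall>i\<in>A. \<forall>j\<in>{1..} - A. norm (x j) \<le> norm (x i)"
  shows "sup_norm (restrict_seq A x) \<le> 3 * sup_norm x"
proof (rule sup_norm_leI)
  define c where "c = sup_norm x"
  have bx: "bounded_seq x" using x by (rule sup_space_bounded)
  have c: "p x \<le> c" if "p \<in> seminorms" for p
    unfolding c_def using seminorm_le_sup_norm[OF bx that] .
  have c0: "0 \<le> c" unfolding c_def using bx by (rule sup_norm_nonneg)
  fix p assume p: "p \<in> seminorms"
  then have "p (restrict_seq A x) \<le> 3 * c"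
  proof (cases p rule: seminorms_cases)
    case (level j B)
    then show ?thesis using level_restrict_le[of B j A x] c[OF p] c0 by simp
  next
    case (block m)
    then show ?thesis using block_restrict_le[of m A x] c[OF p] c0 by simp
  next
    case (partial n)
    consider "A = {}" | "A \<noteq> {}" "\<exists>i\<in>A. x i = 0" | "A \<noteq> {}" "\<forall>i\<in>A. x i \<noteq> 0" by blast
    then show ?thesis
    proof cases
      case 1
      then have "restrict_seq A x = 0" by (auto simp: restrict_seq_def)
      then show ?thesis using seminorm_zero[OF p] c0 by simp
    next
      case 2
      \<comment> \<open>A zero coefficient in a greedy set forces all coefficients outside it to
        vanish, so the projection changes nothing.\<close>
      then have "x j = 0" if "1 \<le> j" "j \<notin> A" for j
        using greedy that by fastforce
      then have "(\<Sum>i\<in>{1..n}. w i *\<^sub>R restrict_seq A x i) = (\<Sum>i\<in>{1..n}. w i *\<^sub>R x i)"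
        by (intro sum.cong) (auto simp: restrict_seq_def)
      then have "p (restrict_seq A x) = p x" by (simp add: partial partial_sum_seminorm_def)
      then show ?thesis using c[OF p] c0 by simp
    next
      case 3
      define t where "t = Min ((\<lambda>i. norm (x i)) ` A)"
      have t: "0 < t" "\<And>i. i \<in> A \<Longrightarrow> t \<le> norm (x i)"
        using 3 A(1) by (auto simp: t_def)
      have "t \<in> (\<lambda>i. norm (x i)) ` A" unfolding t_def using 3 A(1) by (intro Min_in) auto
      then have t_out: "norm (x i) \<le> t" if "1 \<le> i" "i \<notin> A" for i
        using greedy that by auto
      \<comment> \<open>Chosen so that \<open>J * t \<le> c < (J + 1) * t\<close>: the left
        inequality bounds the small coefficients of early level, the right one the number of large
        coefficients.\<close>
      define J where "J = nat \<lfloor>c / t\<rfloor>"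
      have "0 \<le> c / t" using c0 t(1) by simp
      then have J: "real J \<le> c / t" "c / t < real (J + 1)"
        unfolding J_def by (simp_all add: of_nat_nat) linarith+
      then have J': "real J * t \<le> c" "c < real (J + 1) * t"
        using t(1) by (simp_all add: field_simps)
      \<comment> \<open>Otherwise \<open>N J\<close> coefficients of size at least \<open>t\<close>
        would make a seminorm of level \<open>J\<close> at least \<open>(J + 1) * t\<close>.\<close>
      have cardA: "card A \<le> N J"
      proof (rule ccontr)
        assume "\<not> card A \<le> N J"
        then obtain B where B: "B \<subseteq> A" "card B = N J" "finite B"
          by (metis nat_le_linear obtain_subset_with_card_n)
        have "real (J + 1) * t = real (J + 1) / real (N J) * (\<Sum>i\<in>B. t)"
          using B N_pos[of J] by simp
        also have "\<dots> \<le> level_seminorm J B x"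
          unfolding level_seminorm_def using B t(2) by (intro mult_left_mono sum_mono) auto
        also have "\<dots> \<le> c" by (rule c[OF level_in]) (use B A in auto)
        finally show False using J'(2) by simp
      qed
      define U where "U = (\<Union>l<J. E l)"
      have finU: "finite U" by (simp add: U_def finite_E)
      \<comment> \<open>Up to indices of weight zero, the indices of level below \<open>J\<close> form an initial segment.\<close>
      obtain n' where n': "(\<Sum>i\<in>{1..n} \<inter> U. w i *\<^sub>R x i) = (\<Sum>i\<in>{1..n'}. w i *\<^sub>R x i)"
      proof (cases "{1..n} \<inter> U = {}")
        case True
        then show ?thesis using that[of 0] by simp
      next
        case False
        define n' where "n' = Max ({1..n} \<inter> U)"
        have n'U: "n' \<in> {1..n} \<inter> U" unfolding n'_def using False by (intro Max_in) auto
        then obtain k where k: "k < J" "n' \<in> E k" by (auto simp: U_def)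
        have sub: "{1..n} \<inter> U \<subseteq> {1..n'}" unfolding n'_def by auto
        have "w i = 0" if "i \<in> {1..n'}" "i \<notin> {1..n} \<inter> U" for i
        proof (rule ccontr)
          assume "w i \<noteq> 0"
          then obtain l where l: "i \<in> E l" using w_outside by blast
          have "i \<notin> U" using that n'U by auto
          then have "J \<le> l" using l by (auto simp: U_def not_less[symmetric])
          then have "n' < i" using E_less[of k l n' i] k l by auto
          then show False using that(1) by simp
        qed
        then have "(\<Sum>i\<in>{1..n'}. w i *\<^sub>R x i) = (\<Sum>i\<in>{1..n} \<inter> U. w i *\<^sub>R x i)"
          by (intro sum.mono_neutral_right sub) auto
        then show ?thesis using that by metis
      qed
      have "partial_sum_seminorm n' x \<le> c" by (rule c[OF partial_in])
      then have b1: "norm (\<Sum>i\<in>{1..n} \<inter> U. w i *\<^sub>R x i) \<le> c"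
        unfolding n' partial_sum_seminorm_def .
      have "norm (\<Sum>i\<in>{1..n} \<inter> U - A. w i *\<^sub>R x i) \<le> (\<Sum>i\<in>{1..n} \<inter> U - A. w i * t)"
        by (rule norm_sum[THEN order_trans], rule sum_mono)
          (use t_out w_nonneg in \<open>auto intro: mult_left_mono\<close>)
      also have "\<dots> \<le> (\<Sum>i\<in>U. w i * t)"
        by (rule sum_mono2) (use finU w_nonneg t(1) in auto)
      also have "\<dots> = real J * t"
        unfolding sum_distrib_right[symmetric] U_def using sum_w_UN[of "{..<J}"] by simp
      also note J'(1)
      finally have b2: "norm (\<Sum>i\<in>{1..n} \<inter> U - A. w i *\<^sub>R x i) \<le> c" .
      have "norm (\<Sum>i\<in>{1..n} \<inter> A - U. w i *\<^sub>R x i) \<le>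
          (\<Sum>i\<in>{1..n} \<inter> A - U. 1 / real (N J) * norm (x i))"
      proof (rule norm_sum[THEN order_trans], rule sum_mono)
        fix i assume "i \<in> {1..n} \<inter> A - U"
        then have "w i \<le> 1 / real (N J)" by (intro w_late_le) (auto simp: U_def)
        then have "w i * norm (x i) \<le> 1 / real (N J) * norm (x i)" by (rule mult_right_mono) simp
        then show "norm (w i *\<^sub>R x i) \<le> 1 / real (N J) * norm (x i)"
          using w_nonneg[of i] by simp
      qed
      also have "\<dots> \<le> (\<Sum>i\<in>A. real (J + 1) / real (N J) * norm (x i))"
      proof (rule sum_mono2[THEN order_trans[rotated]])
        show "(\<Sum>i\<in>{1..n} \<inter> A - U. 1 / real (N J) * norm (x i)) \<le>
          (\<Sum>i\<in>{1..n} \<inter> A - U. real (J + 1) / real (N J) * norm (x i))"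
          by (intro sum_mono mult_right_mono divide_right_mono) auto
      qed (use A in auto)
      also have "\<dots> = level_seminorm J A x"
        by (simp only: level_seminorm_def sum_distrib_left)
      also have "\<dots> \<le> c" by (rule c[OF level_in]) (use A cardA in auto)
      finally have b3: "norm (\<Sum>i\<in>{1..n} \<inter> A - U. w i *\<^sub>R x i) \<le> c" .
      have "(\<Sum>i\<in>{1..n}. w i *\<^sub>R restrict_seq A x i) = (\<Sum>i\<in>{1..n} \<inter> A. w i *\<^sub>R x i)"
        by (intro sum.mono_neutral_cong_right) (auto simp: restrict_seq_def)
      also have "\<dots> = (\<Sum>i\<in>{1..n} \<inter> A \<inter> U. w i *\<^sub>R x i) + (\<Sum>i\<in>{1..n} \<inter> A - U. w i *\<^sub>R x i)"
        by (rule sum.Int_Diff) simp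
      also have "(\<Sum>i\<in>{1..n} \<inter> A \<inter> U. w i *\<^sub>R x i) =
          (\<Sum>i\<in>{1..n} \<inter> U. w i *\<^sub>R x i) - (\<Sum>i\<in>{1..n} \<inter> U - A. w i *\<^sub>R x i)"
        using sum.Int_Diff[of "{1..n} \<inter> U" "\<lambda>i. w i *\<^sub>R x i" A] by (simp add: Int_ac)
      finally have "p (restrict_seq A x) = norm ((\<Sum>i\<in>{1..n} \<inter> U. w i *\<^sub>R x i) -
          (\<Sum>i\<in>{1..n} \<inter> U - A. w i *\<^sub>R x i) + (\<Sum>i\<in>{1..n} \<inter> A - U. w i *\<^sub>R x i))"
        by (simp only: partial partial_sum_seminorm_def)
      also have "\<dots> \<le> (c + c) + c"
        by (rule order_trans[OF norm_triangle_ineq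
              add_mono[OF order_trans[OF norm_triangle_ineq4 add_mono[OF b1 b2]] b3]])
      finally show ?thesis by simp
    qed
  qed
  then show "p (restrict_seq A x) \<le> 3 * sup_norm x" by (simp add: c_def)
qed

lemma quasi_greedy: quasi_greedy
  by (rule quasi_greedyI[of 3]) (use greedy_projection_bound in auto)

section \<open>Unconditionality and democracy on families of small mass\<close>

text \<open>On \<open>A\<close> the partial sums are at most the mass of \<open>A\<close> times the
  largest coordinate.\<close>

lemma unconditional_forI:
  assumes "\<And>A. A \<in> F \<Longrightarrow> finite A \<and> A \<subseteq> {1..}" "\<And>A. A \<in> F \<Longrightarrow> sum w A \<le> 2"
  shows "unconditional_for F"
proof -
  have "sup_norm (proj A x) \<le> 2 * sup_norm x" if x: "x \<in> sup_space" and A: "A \<in> F" for x A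
  proof -
    have fin: "finite A" "A \<subseteq> {1..}" using assms(1)[OF A] by auto
    have bx: "bounded_seq x" using x by (rule sup_space_bounded)
    have "0 \<le> sup_norm x" using bx by (rule sup_norm_nonneg)
    have "sup_norm (restrict_seq A x) \<le> 2 * sup_norm x"
    proof (rule sup_norm_leI)
      fix p assume p: "p \<in> seminorms"
      note px = seminorm_le_sup_norm[OF bx p]
      show "p (restrict_seq A x) \<le> 2 * sup_norm x"
        using p
      proof (cases p rule: seminorms_cases)
        case (level j B)
        then show ?thesis using level_restrict_le[of B j A x] px \<open>0 \<le> sup_norm x\<close> by simp
      next
        case (block m)
        then show ?thesis using block_restrict_le[of m A x] px \<open>0 \<le> sup_norm x\<close> by simp
      next
        case (partial n)
        have "p (restrict_seq A x) \<le> (\<Sum>i\<in>A. w i * norm (x i))"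
          unfolding partial by (rule partial_restrict_le[OF fin(1)])
        also have "\<dots> \<le> (\<Sum>i\<in>A. w i * sup_norm x)"
          using norm_coordinate_le[OF bx] fin(2)
          by (intro sum_mono mult_left_mono w_nonneg) auto
        also have "\<dots> = sum w A * sup_norm x" by (simp add: sum_distrib_right)
        also have "\<dots> \<le> 2 * sup_norm x"
          using assms(2)[OF A] \<open>0 \<le> sup_norm x\<close> by (rule mult_right_mono)
        finally show ?thesis .
      qed
    qed
    then show ?thesis using proj_eq[OF x fin(1)] by simp
  qed
  then show ?thesis unfolding unconditional_for_def by (intro exI[of _ 2]) auto
qed

lemma level_seminorm_one:
  "finite B \<Longrightarrow> level_seminorm j B (restrict_seq A (\<lambda>_. 1)) = real (j + 1) / real (N j) * real (card (A \<inter> B))"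
  by (simp add: level_seminorm_def restrict_seq_def if_distrib[of norm] sum.If_cases Int_commute cong: if_cong)

lemma block_seminorm_one:
  "block_seminorm m (restrict_seq A (\<lambda>_. 1)) = sum (v m) (A \<inter> G m)"
proof -
  have "(\<Sum>i\<in>G m. v m i * norm (restrict_seq A (\<lambda>_. 1) i :: 'f)) = (\<Sum>i\<in>A \<inter> G m. v m i)"
    by (intro sum.mono_neutral_cong_right) (auto simp: finite_G restrict_seq_def)
  then show ?thesis by (simp add: block_seminorm_def)
qed

lemma partial_sum_seminorm_one_le:
  "finite A \<Longrightarrow> partial_sum_seminorm n (restrict_seq A (\<lambda>_. 1)) \<le> sum w A"
  using partial_restrict_le[of A n "\<lambda>_. 1"] by simp

text \<open>Level seminorms of \<open>one A\<close> depend only on the number of points used, and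
  \<open>B\<close> offers as many. If \<open>j\<close> is the least level with
  \<open>card A \<le> N j\<close>, the mass of \<open>A\<close> is at most \<open>j + 1\<close>,
  while for \<open>j > 0\<close> the previous level gives \<open>one B\<close> norm at least
  \<open>j\<close>. As the norm is also at least 1 for nonempty \<open>A\<close>, the factor 2
  suffices.\<close>

lemma democratic_forI:
  assumes "\<And>A. A \<in> F \<Longrightarrow> finite A" "\<And>A m. A \<in> F \<Longrightarrow> sum (v m) (A \<inter> G m) \<le> 1"
  shows "democratic_for F"
proof -
  have "sup_norm (one A) \<le> 2 * sup_norm (one B)"
    if A: "A \<in> F" and B: "B \<subseteq> {1..}" "finite B" "card A \<le> card B" for A B
  proof -
    define b where "b = sup_norm (one B)"
    have fin: "finite A" using assms(1)[OF A] .
    have oneB: "p (restrict_seq B (\<lambda>_. 1)) \<le> b" if "p \<in> seminorms" for p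
      unfolding b_def one_eq[OF B(2)]
      by (rule seminorm_le_sup_norm[OF bounded_seq_restrict[OF B(2,1)] that])
    have b0: "0 \<le> b"
      unfolding b_def one_eq[OF B(2)] by (rule sup_norm_nonneg[OF bounded_seq_restrict[OF B(2,1)]])
    have level_le: "real (j + 1) / real (N j) * real k \<le> b" if k: "k \<le> card B" "k \<le> N j" for j k
    proof -
      obtain B' where B': "B' \<subseteq> B" "card B' = k" "finite B'"
        using obtain_subset_with_card_n[OF k(1)] by blast
      then have "level_seminorm j B' (restrict_seq B (\<lambda>_. 1)) \<le> b"
        using B(1) k(2) by (intro oneB level_in) auto
      then show ?thesis using B' by (simp add: level_seminorm_one Int_absorb1)
    qed
    have one_le: "1 \<le> b" if "A \<noteq> {}"
    proof -
      have "card A \<noteq> 0" using that fin by simp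
      then have "1 \<le> card B" using B(3) by linarith
      then show ?thesis using level_le[of 1 0] by (simp add: N_0)
    qed
    have "sup_norm (restrict_seq A (\<lambda>_. 1)) \<le> 2 * b"
    proof (rule sup_norm_leI)
      fix p assume p: "p \<in> seminorms"
      show "p (restrict_seq A (\<lambda>_. 1)) \<le> 2 * b"
      proof (cases "A = {}")
        case True
        then have "restrict_seq A (\<lambda>_. 1) = (0 :: nat \<Rightarrow> 'f)" by (auto simp: restrict_seq_def)
        then show ?thesis using seminorm_zero[OF p] b0 by simp
      next
        case False
        from p show ?thesis
        proof (cases p rule: seminorms_cases)
          case (level j A')
          have "p (restrict_seq A (\<lambda>_. 1)) = real (j + 1) / real (N j) * real (card (A \<inter> A'))"
            unfolding level(1) by (rule level_seminorm_one[OF level(2)])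
          also have "\<dots> \<le> b"
          proof (rule level_le)
            show "card (A \<inter> A') \<le> card B"
              using card_mono[OF fin, of "A \<inter> A'"] B(3) by simp
            show "card (A \<inter> A') \<le> N j"
              using card_mono[OF level(2), of "A \<inter> A'"] level(4) by simp
          qed
          finally show ?thesis using b0 by simp
        next
          case (block m)
          then show ?thesis
            using assms(2)[OF A, of m] one_le[OF False] by (simp add: block_seminorm_one)
        next
          case (partial n)
          define j where "j = (LEAST j. card A \<le> N j)"
          have "card A \<le> N (card A)" using N_ge[of "card A"] by simp
          then have j: "card A \<le> N j" unfolding j_def by (rule LeastI)
          have "p (restrict_seq A (\<lambda>_. 1)) \<le> sum w A"
            unfolding partial by (rule partial_sum_seminorm_one_le[OF fin])
          also have "\<dots> \<le> real (j + 1)" by (rule sum_w_le[OF fin j])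
          also have "\<dots> \<le> 2 * b"
          proof (cases j)
            case 0
            then show ?thesis using one_le[OF False] by simp
          next
            case (Suc k)
            then have "\<not> card A \<le> N k" using not_less_Least[of k "\<lambda>j. card A \<le> N j"] by (simp add: j_def)
            then have "real (k + 1) / real (N k) * real (N k) \<le> b"
              using B(3) by (intro level_le) auto
            then have "real j \<le> b" using N_pos[of k] Suc by simp
            then show ?thesis using one_le[OF False] by simp
          qed
          finally show ?thesis .
        qed
      qed
    qed
    then show ?thesis unfolding b_def one_eq[OF fin] .
  qed
  then show ?thesis unfolding democratic_for_def by (intro exI[of _ 2]) auto
qed

section \<open>Failure of democracy and of unconditionality\<close>

text \<open>Each \<open>one (G m)\<close> has norm at least \<open>(m + 1)\<^sup>2\<close>, but
  equally many units in \<open>Y\<close> are invisible to the block seminorms and have norm at most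
  \<open>m + 2\<close>.\<close>

lemma not_democratic_forI:
  assumes Y: "infinite Y" "Y \<subseteq> {1..}" "\<And>m. Y \<inter> G m = {}"
    and card_G: "\<And>m. card (G m) \<le> N (m + 1)" and mass_G: "\<And>m. sum (v m) (G m) = real ((m + 1)\<^sup>2)"
    and G_in: "\<And>m. G m \<in> F"
  shows "\<not> democratic_for F"
proof
  assume "democratic_for F"
  then obtain C where C: "0 < C" "\<And>A B. A \<in> F \<Longrightarrow> B \<subseteq> {1..} \<Longrightarrow> finite B \<Longrightarrow> card A \<le> card B \<Longrightarrow>
      sup_norm (one A) \<le> C * sup_norm (one B)"
    unfolding democratic_for_def by blast
  \<comment> \<open>This contradicts the constant \<open>C\<close>, as
    \<open>C * (m + 2) \<le> 2 * C * (m + 1) < m * (m + 1)\<close>.\<close>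
  obtain m :: nat where m: "2 * C < real m" using reals_Archimedean2 by blast
  obtain B where B: "finite B" "card B = card (G m)" "B \<subseteq> Y"
    using infinite_arbitrarily_large[OF Y(1)] by blast
  have cardB: "card B \<le> N (m + 1)" using B(2) card_G by simp
  have "real ((m + 1)\<^sup>2) = block_seminorm m (restrict_seq (G m) (\<lambda>_. 1))"
    using mass_G[of m] by (simp add: block_seminorm_one)
  also have "\<dots> \<le> sup_norm (one (G m))"
    unfolding one_eq[OF finite_G]
    by (intro seminorm_le_sup_norm bounded_seq_restrict finite_G G_pos block_in)
  also have "\<dots> \<le> C * sup_norm (one B)"
    using B Y(2) by (intro C(2) G_in) auto
  also have "sup_norm (one B) \<le> real (m + 2)"
    unfolding one_eq[OF B(1)]
  proof (rule sup_norm_leI)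
    fix p assume "p \<in> seminorms"
    then show "p (restrict_seq B (\<lambda>_. 1)) \<le> real (m + 2)"
    proof (cases p rule: seminorms_cases)
      case (level j A)
      have le: "card (B \<inter> A) \<le> card B" "card (B \<inter> A) \<le> N j"
        using card_mono[OF B(1), of "B \<inter> A"] card_mono[OF level(2), of "B \<inter> A"] level(4) by auto
      \<comment> \<open>Up to level \<open>m + 1\<close> the factor \<open>j + 1\<close> is at most
        \<open>m + 2\<close>; at higher levels the growth of \<open>N\<close> outweighs the
        factor.\<close>
      have "(j + 1) * card (B \<inter> A) \<le> (m + 2) * N j"
      proof (cases "j \<le> m + 1")
        case True
        then show ?thesis using le(2) by (intro mult_le_mono) auto
      next
        case False
        have "(j + 1) * card (B \<inter> A) \<le> (j + 1) * N (m + 1)"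
          using le(1) cardB by (intro mult_le_mono) auto
        also have "\<dots> \<le> N j" using False by (intro N_growth) simp
        finally show ?thesis by simp
      qed
      then have "real (j + 1) * real (card (B \<inter> A)) \<le> real (m + 2) * real (N j)"
        unfolding of_nat_mult[symmetric] by (rule of_nat_mono)
      then show ?thesis
        using N_pos[of j] by (simp add: level(1) level_seminorm_one[OF level(2)] divide_le_eq)
    next
      case (partial n)
      then show ?thesis
        using partial_sum_seminorm_one_le[OF B(1), of n] sum_w_le[OF B(1) cardB] by simp
    next
      case (block k)
      have "B \<inter> G k = {}" using B(3) Y(3)[of k] by blast
      then show ?thesis by (simp add: block block_seminorm_one)
    qed
  qed
  finally have "real ((m + 1)\<^sup>2) \<le> C * real (m + 2)" using C(1) by simp
  also have "\<dots> \<le> C * (2 * real (m + 1))" using C(1) by (intro mult_left_mono) auto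
  also have "\<dots> < real m * real (m + 1)"
    using mult_strict_right_mono[OF m, of "real (m + 1)"] by (simp add: algebra_simps)
  finally show False by (simp add: power2_eq_square algebra_simps)
qed

lemma not_unconditional_forI:
  assumes "\<And>H. \<exists>a r. (\<forall>A. A \<subseteq> (\<Union>j\<in>{a..<r}. E j) \<longrightarrow> A \<in> F) \<and>
      (H :: real) \<le> (\<Sum>j\<in>{a..<r}. 1 / real (j + 1))"
  shows "\<not> unconditional_for F"
proof
  assume "unconditional_for F"
  then obtain C where C: "0 < C" "\<And>x A. x \<in> sup_space \<Longrightarrow> A \<in> F \<Longrightarrow>
      sup_norm (proj A x) \<le> C * sup_norm x"
    unfolding unconditional_for_def by blast
  \<comment> \<open>As the signed sum is at least -1, the positive part has a sum of at least
    \<open>(4 * C + 1) / 2\<close>, which exceeds the bound \<open>2 * C\<close> that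
    unconditionality would give.\<close>
  obtain a r where F: "\<And>A. A \<subseteq> (\<Union>j\<in>{a..<r}. E j) \<Longrightarrow> A \<in> F"
    and H: "4 * C + 2 \<le> (\<Sum>j\<in>{a..<r}. 1 / real (j + 1))"
    using assms[of "4 * C + 2"] by blast
  define W where "W = (\<Union>j\<in>{a..<r}. E j)"
  have W: "finite W" "W \<subseteq> {1..}" using finite_E E_pos by (auto simp: W_def)
  define lev where "lev = (\<lambda>i. LEAST j. i \<in> E j)"
  have lev: "lev i = j" if "i \<in> E j" for i j
    unfolding lev_def
  proof (rule Least_equality)
    show "j \<le> k" if "i \<in> E k" for k
      using E_less[of k j i i] \<open>i \<in> E j\<close> that by (meson less_irrefl not_less)
  qed (rule that)
  define y where "y = (\<lambda>i. if i \<in> W then 1 / real (lev i + 1) else 0)"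
  have y: "0 \<le> y i" "y i \<le> 1" for i by (auto simp: y_def)
  have y_late: "y i \<le> 1 / real (k + 1)" if "\<And>l. l < k \<Longrightarrow> i \<notin> E l" for i k
  proof (cases "i \<in> W")
    case True
    then obtain j where j: "i \<in> E j" by (auto simp: W_def)
    then have "k \<le> j" using that[of j] by (auto simp: not_less[symmetric])
    then show ?thesis using j True by (simp add: y_def lev frac_le)
  qed (simp add: y_def)
  have "0 \<le> w i * y i" "w i * y i \<le> 1" for i
    using w_nonneg[of i] w_le_1[of i] y[of i] by (auto intro: mult_le_one)
  from ex_signs_bounded_partial_sums[of "\<lambda>i. w i * y i", OF this] obtain s where
    s: "\<And>i. s i = 1 \<or> s i = -1" "\<And>n. \<bar>\<Sum>i\<in>{1..n}. s i * (w i * y i)\<bar> \<le> 1"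
    by blast
  define x :: "nat \<Rightarrow> 'f" where "x = (\<lambda>i. of_real (s i * y i))"
  have norm_x: "norm (x i) = y i" for i
    using s(1)[of i] y(1)[of i] by (auto simp: x_def)
  have xW: "x = restrict_seq W x"
    by (auto simp: x_def restrict_seq_def y_def)
  have x: "x \<in> sup_space"
    by (subst xW) (rule finite_support_in_sup_space[OF W])
  have "sup_norm x \<le> 2"
  proof (rule sup_norm_leI)
    fix p assume "p \<in> seminorms"
    then show "p x \<le> 2"
    proof (cases p rule: seminorms_cases)
      case (level k A)
      \<comment> \<open>By \<open>N_ge_card\<close> the earlier sets have at most
        \<open>N k / (k + 1)\<close> points, with values at most 1; the others number at most
        \<open>N k\<close>, with values at most \<open>1 / (k + 1)\<close>. Each group contributes
        at most 1 to the seminorm.\<close>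
      define U where "U = (\<Union>l<k. E l)"
      have finU: "finite U" by (simp add: U_def finite_E)
      have "(\<Sum>i\<in>A. y i) = (\<Sum>i\<in>A \<inter> U. y i) + (\<Sum>i\<in>A - U. y i)"
        using level(2) by (rule sum.Int_Diff)
      also have "(\<Sum>i\<in>A \<inter> U. y i) \<le> real (card (A \<inter> U)) * 1"
        by (rule sum_bounded_above) (rule y)
      also have "\<dots> \<le> real (\<Sum>l<k. card (E l))"
        using order_trans[OF card_mono[OF finU, of "A \<inter> U"] card_UN_le[of "{..<k}" E, folded U_def]]
        by (simp only: mult_1_right of_nat_le_iff) simp
      also have "(\<Sum>i\<in>A - U. y i) \<le> real (card (A - U)) * (1 / real (k + 1))"
        by (rule sum_bounded_above) (use y_late in \<open>auto simp: U_def\<close>)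
      also have "\<dots> \<le> real (N k) * (1 / real (k + 1))"
        using card_mono[OF level(2), of "A - U"] level(4) by (intro mult_right_mono) auto
      finally have "real (k + 1) * (\<Sum>i\<in>A. y i) \<le>
          real (k + 1) * (real (\<Sum>l<k. card (E l)) + real (N k) * (1 / real (k + 1)))"
        by (intro mult_left_mono) auto
      also have "\<dots> = real ((k + 1) * (\<Sum>l<k. card (E l))) + real (N k)"
        by (simp add: distrib_left del: of_nat_Suc of_nat_sum mult_Suc)
      also have "\<dots> \<le> 2 * real (N k)"
        using of_nat_mono[OF N_ge_card[of k], where ?'a = real] by linarith
      finally show ?thesis
        using N_pos[of k] by (simp add: level(1) level_seminorm_def norm_x divide_le_eq)
    next
      case (partial n)
      have "(\<Sum>i\<in>{1..n}. w i *\<^sub>R x i) = of_real (\<Sum>i\<in>{1..n}. s i * (w i * y i))"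
        unfolding of_real_sum by (intro sum.cong) (auto simp: x_def scaleR_conv_of_real)
      then show ?thesis using s(2)[of n] by (simp add: partial partial_sum_seminorm_def norm_of_real del: of_real_sum)
    next
      case (block m)
      have "v m i * norm (x i) = 0" if "i \<in> G m" for i
        using that E_G_disjoint unfolding norm_x y_def W_def by auto
      then have "block_seminorm m x = 0" unfolding block_seminorm_def by (intro sum.neutral) blast
      then show ?thesis by (simp add: block)
    qed
  qed
  define P where "P = {i \<in> W. s i = 1}"
  have P: "finite P" "P \<subseteq> W" using W by (auto simp: P_def)
  obtain n where n: "W \<subseteq> {1..n}"
  proof -
    obtain n where "\<forall>i\<in>W. i \<le> n" using W(1) finite_nat_set_iff_bounded_le by blast
    then have "W \<subseteq> {1..n}" using W(2) by fastforce
    then show ?thesis by (rule that)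
  qed
  have "(\<Sum>i\<in>W. w i * y i) = (\<Sum>j\<in>{a..<r}. \<Sum>i\<in>E j. w i * y i)"
    unfolding W_def using E_disjoint by (intro sum.UNION_disjoint) (auto simp: finite_E)
  also have "\<dots> = (\<Sum>j\<in>{a..<r}. 1 / real (j + 1))"
  proof (rule sum.cong[OF refl])
    fix j assume j: "j \<in> {a..<r}"
    have "(\<Sum>i\<in>E j. w i * y i) = (\<Sum>i\<in>E j. w i * (1 / real (j + 1)))"
      by (intro sum.cong refl) (use j lev in \<open>auto simp: y_def W_def\<close>)
    then show "(\<Sum>i\<in>E j. w i * y i) = 1 / real (j + 1)"
      using sum_w_E[of j] unfolding sum_distrib_right[symmetric] by simp
  qed
  finally have sumW: "4 * C + 2 \<le> (\<Sum>i\<in>W. w i * y i)" using H by simp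
  have "(\<Sum>i\<in>{1..n}. s i * (w i * y i)) = (\<Sum>i\<in>W. s i * (w i * y i))"
    using n by (intro sum.mono_neutral_right) (auto simp: y_def)
  then have "-1 \<le> (\<Sum>i\<in>W. s i * (w i * y i))" using s(2)[of n] by (simp add: abs_le_iff)
  \<comment> \<open>Adding the moduli cancels the terms with sign -1 and doubles those with sign
    1.\<close>
  moreover have "(\<Sum>i\<in>W. s i * (w i * y i)) + (\<Sum>i\<in>W. w i * y i) = 2 * (\<Sum>i\<in>P. w i * y i)"
  proof -
    have "(\<Sum>i\<in>W. s i * (w i * y i)) + (\<Sum>i\<in>W. w i * y i) =
        (\<Sum>i\<in>W. if s i = 1 then 2 * (w i * y i) else 0)"
      unfolding sum.distrib[symmetric]
    proof (rule sum.cong[OF refl])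
      show "s i * (w i * y i) + w i * y i = (if s i = 1 then 2 * (w i * y i) else 0)" for i
        using s(1)[of i] by auto
    qed
    also have "\<dots> = (\<Sum>i\<in>P. 2 * (w i * y i))"
      unfolding P_def using W(1) by (simp add: sum.inter_filter)
    finally show ?thesis by (simp add: sum_distrib_left)
  qed
  ultimately have big: "2 * C < (\<Sum>i\<in>P. w i * y i)" using sumW by simp
  have "(\<Sum>i\<in>{1..n}. w i *\<^sub>R restrict_seq P x i) = (\<Sum>i\<in>P. w i *\<^sub>R x i)"
    using n P by (intro sum.mono_neutral_cong_right) (auto simp: restrict_seq_def)
  also have "\<dots> = of_real (\<Sum>i\<in>P. w i * y i)"
    unfolding of_real_sum by (intro sum.cong) (auto simp: P_def x_def scaleR_conv_of_real)
  finally have "(\<Sum>i\<in>P. w i * y i) \<le> partial_sum_seminorm n (restrict_seq P x)"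
    by (simp add: partial_sum_seminorm_def norm_of_real del: of_real_sum)
  also have "\<dots> \<le> sup_norm (restrict_seq P x)"
    using P W by (intro seminorm_le_sup_norm bounded_seq_restrict partial_in) auto
  also have "\<dots> = sup_norm (proj P x)" using proj_eq[OF x P(1)] by simp
  also have "\<dots> \<le> C * sup_norm x"
    using P(2) by (intro C(2) x F) (simp add: W_def)
  also have "\<dots> \<le> C * 2" using \<open>sup_norm x \<le> 2\<close> C(1) by (intro mult_left_mono) auto
  finally show False using big by simp
qed

end

section \<open>Existence of the bases\<close>

text \<open>Tails of the harmonic series are unbounded. Asking the sum from \<open>a\<close> on to
  reach \<open>a\<close> itself makes one function \<open>r\<close> serve every bound.\<close>

lemma ex_harmonic_block: "\<exists>r. \<forall>a. real a \<le> (\<Sum>j\<in>{a..<r a}. 1 / real (j + 1))"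
proof -
  have "\<exists>r. real a \<le> (\<Sum>j\<in>{a..<r}. 1 / real (j + 1))" for a
  proof (rule ccontr)
    assume "\<not> ?thesis"
    then have le: "(\<Sum>j\<in>{a..<r}. 1 / real (j + 1)) \<le> real a" for r
      by (metis less_imp_le not_le)
    have "summable (\<lambda>j. 1 / real (j + a + 1))"
    proof (rule bounded_imp_summable)
      show "(\<Sum>j\<le>n. 1 / real (j + a + 1)) \<le> real a" for n
      proof -
        have "(\<Sum>j\<le>n. 1 / real (j + a + 1)) = (\<Sum>j\<in>{0+a..<Suc n+a}. 1 / real (j + 1))"
          unfolding sum.shift_bounds_nat_ivl by (simp add: lessThan_Suc_atMost[symmetric] atLeast0LessThan)
        then show ?thesis using le[of "Suc n + a"] by simp
      qed
    qed simp
    then have "summable (\<lambda>j. inverse (real (j + (a + 1))))"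
      by (simp add: inverse_eq_divide add.assoc)
    then have "summable (\<lambda>j. inverse (real j))"
      by (rule summable_iff_shift[THEN iffD1])
    then show False using not_summable_harmonic[where ?'a = real] by simp
  qed
  then show ?thesis by metis
qed

section \<open>Choice of the parameters\<close>

text \<open>The sets \<open>E\<close> live on odd indices and the sets \<open>G\<close> on even
  ones, so that the failure of unconditionality and that of democracy do not interfere.\<close>

lemma (in schreier_families) ex_quasi_greedy_basis_of_type:
  "\<exists>(V :: (nat \<Rightarrow> 'f::{real_normed_field,banach}) set) nrm e.
     quasi_greedy_basis_of_type lam \<alpha> \<beta> seq_scale V nrm e"
proof -
  have inf_odd: "infinite {i :: nat. odd i}" and inf_even: "infinite {i :: nat. even i \<and> 1 \<le> i}"
  proof -
    have "\<exists>n>m. odd n" "\<exists>n>m. even n \<and> 1 \<le> n" for m :: nat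
      by (rule exI[of _ "2 * m + 1"], simp, rule exI[of _ "2 * m + 2"], simp)
    then show "infinite {i :: nat. odd i}" "infinite {i :: nat. even i \<and> 1 \<le> i}"
      unfolding infinite_nat_iff_unbounded by simp_all
  qed
  \<comment> \<open>The tolerance is undone by the factor in \<open>v\<close>: total mass
    \<open>(m + 1)\<^sup>2\<close>, but at most 1 on members of family \<open>\<beta>\<close> and,
    through family 0, at single points.\<close>
  define Q where "Q = (\<lambda>m F u. probability_on F u \<and> F \<subseteq> {i. even i \<and> 1 \<le> i} \<and>
      F \<in> schreier lam (osuc \<beta>) \<and>
      (\<forall>g\<in>{0, \<beta>}. \<forall>A\<in>schreier lam g. sum u A \<le> 1 / real ((m + 1)\<^sup>2)))"
  have "\<exists>F u. Q m F u" for m :: nat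
  proof -
    have "{0, \<beta>} \<subseteq> {..<osuc \<beta>}"
      using less_osuc less_osuc_iff zero_le_countable_ordinal by auto
    have e: "0 < 1 / real ((m + 1)\<^sup>2)" by simp
    obtain F u where "probability_on F u" "F \<subseteq> {i. even i \<and> 1 \<le> i}"
      "\<forall>x\<in>F. 0 < x" "F \<in> schreier lam (osuc \<beta>)"
      "\<forall>g\<in>{0, \<beta>}. \<forall>A\<in>schreier lam g. sum u A \<le> 1 / real ((m + 1)\<^sup>2)"
      by (rule averages_existE[OF averages_exist inf_even _ _ \<open>{0, \<beta>} \<subseteq> {..<osuc \<beta>}\<close> e]) auto
    then show ?thesis unfolding Q_def by (intro exI conjI)
  qed
  then obtain G u where Q: "\<And>m. Q m (G m) (u m)" by metis
  then have G: "\<And>m. probability_on (G m) (u m)" "\<And>m. G m \<subseteq> {i. even i \<and> 1 \<le> i}"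
      "\<And>m. G m \<in> schreier lam (osuc \<beta>)"
    and u: "\<And>m g A. g \<in> {0, \<beta>} \<Longrightarrow> A \<in> schreier lam g \<Longrightarrow> sum (u m) A \<le> 1 / real ((m + 1)\<^sup>2)"
    unfolding Q_def by blast+
  define v where "v = (\<lambda>m i. real ((m + 1)\<^sup>2) * u m i)"
  have sum_v: "sum (v m) A = real ((m + 1)\<^sup>2) * sum (u m) A" for m A
    by (simp only: v_def sum_distrib_left)
  have v_small: "sum (v m) A \<le> 1" if "g \<in> {0, \<beta>}" "A \<in> schreier lam g" for m g A
    using mult_left_mono[OF u[OF that, of m], of "real ((m + 1)\<^sup>2)"] unfolding sum_v by simp
  obtain r where r: "\<And>a. real a \<le> (\<Sum>j\<in>{a..<r a}. 1 / real (j + 1))"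
    using ex_harmonic_block by blast
  \<comment> \<open>The value 1 at 0 gives \<open>N 0 = 1\<close>; the shift makes
    \<open>N (m + 1)\<close> at least \<open>card (G m)\<close>.\<close>
  define f where "f = (\<lambda>j. if j = 0 then 1 else card (G (j - 1)))"
  have "{i :: nat. odd i} \<subseteq> {1..}" by (auto simp: Suc_le_eq odd_pos)
  from weighted_sequence_exists[OF averages_exist inf_odd this, of \<alpha> f r]
  obtain E w where Ew: "weighted_sequence (schreier lam \<alpha>) f {i. odd i} E w"
    and block: "\<And>a. (\<Union>j\<in>{a..<r a}. E j) \<in> schreier lam (osuc \<alpha>)"
    by blast
  define N where "N = weight_denominator f E"
  have E: "finite (E j)" "E j \<subseteq> {i. odd i}" "i < j \<Longrightarrow> x \<in> E i \<Longrightarrow> y \<in> E j \<Longrightarrow> x < y"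
    and w: "0 \<le> w i" "i \<notin> (\<Union>j. E j) \<Longrightarrow> w i = 0" "sum w (E j) = 1"
      "i \<in> E j \<Longrightarrow> w i * real (N j) \<le> 1" "A \<in> schreier lam \<alpha> \<Longrightarrow> sum w A \<le> 2" for i j x y A
    using Ew unfolding weighted_sequence_def N_def by blast+
  \<comment> \<open>Mass 1 with weights at most \<open>1 / real (N j)\<close> needs at least
    \<open>N j\<close> points. The bound on the sizes of earlier sets thus becomes growth of
    \<open>N\<close>.\<close>
  have N_le_card: "N j \<le> card (E j)" for j
  proof -
    have "real (N j) = (\<Sum>i\<in>E j. w i * real (N j))"
      using w(3)[of j] by (simp add: sum_distrib_right[symmetric])
    also have "\<dots> \<le> (\<Sum>i\<in>E j. 1)" by (rule sum_mono) (rule w(4))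
    finally show ?thesis by simp
  qed
  have N_ge: "(l + 1) * (\<Sum>i<l. card (E i)) \<le> N l" for l
    unfolding N_def weight_denominator_def by (rule max.coboundedI2) (rule mult_le_mono, auto)
  interpret conditional_norm E w N G v "TYPE('f)"
  proof
    show "(l + 1) * N i \<le> N l" if "i < l" for i l
    proof -
      have "N i \<le> (\<Sum>i<l. card (E i))"
        using N_le_card[of i] member_le_sum[of i "{..<l}" "\<lambda>i. card (E i)"] that by auto
      then have "(l + 1) * N i \<le> (l + 1) * (\<Sum>i<l. card (E i))" by (rule mult_le_mono2)
      also note N_ge[of l]
      finally show ?thesis .
    qed
    show "N 0 = 1" by (simp add: N_def weight_denominator_def f_def)
    show "E j \<subseteq> {1..}" for j using E(2)[of j] by (auto simp: Suc_le_eq odd_pos)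
    show "E j \<inter> G m = {}" for j m using E(2)[of j] G(2)[of m] by auto
    show "finite (G m)" for m using G(1)[of m] by (simp add: probability_on_def)
    show "G m \<subseteq> {1..}" for m using G(2)[of m] by auto
    show "0 \<le> v m i" for m i using G(1)[of m] by (simp add: v_def probability_on_def)
    show "v m i \<le> 1" if "i \<in> G m" for m i
    proof -
      have "{i} \<in> schreier lam 0" using that G(2)[of m] by (auto simp: schreier_0)
      then show ?thesis using v_small[of 0 "{i}" m] by simp
    qed
  qed (use E w N_ge in auto)
  have "quasi_greedy_basis_of_type lam \<alpha> \<beta> seq_scale sup_space sup_norm unit_seq"
    unfolding quasi_greedy_basis_of_type_def
  proof (intro conjI)
    show "schauder_basis seq_scale sup_space sup_norm unit_seq" by (rule schauder_basis_units)
    show quasi_greedy by (rule quasi_greedy)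
    show "unconditional_for (schreier lam \<alpha>)"
      by (rule unconditional_forI) (use schreier_finite w(5) in auto)
    show "\<not> unconditional_for (schreier lam (osuc \<alpha>))"
    proof (rule not_unconditional_forI)
      fix H :: real
      obtain a :: nat where "H \<le> real a" using real_arch_simple by blast
      then show "\<exists>a r. (\<forall>A. A \<subseteq> (\<Union>j\<in>{a..<r}. E j) \<longrightarrow> A \<in> schreier lam (osuc \<alpha>)) \<and>
          H \<le> (\<Sum>j\<in>{a..<r}. 1 / real (j + 1))"
        using r[of a] schreier_subset[OF block] by (intro exI[of _ a] exI[of _ "r a"]) auto
    qed
    show "democratic_for (schreier lam \<beta>)"
    proof (rule democratic_forI)
      fix A m assume "A \<in> schreier lam \<beta>"
      then have "A \<inter> G m \<in> schreier lam \<beta>" by (rule schreier_subset) simp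
      then show "sum (v m) (A \<inter> G m) \<le> 1" by (rule v_small[rotated]) simp
    qed (use schreier_finite in blast)
    show "\<not> democratic_for (schreier lam (osuc \<beta>))"
    proof (rule not_democratic_forI[OF inf_odd])
      show "card (G m) \<le> N (m + 1)" for m by (simp add: N_def weight_denominator_def f_def)
      show "sum (v m) (G m) = real ((m + 1)\<^sup>2)" for m
        unfolding sum_v using G(1)[of m] by (simp add: probability_on_def)
      show "{i. odd i} \<inter> G m = {}" for m using G(2)[of m] by auto
    qed (use G(3) in \<open>auto simp: Suc_le_eq odd_pos\<close>)
  qed
  then show ?thesis by blast
qed

theorem mainTheorem1:
  fixes lam :: "countable_ordinal \<Rightarrow> nat \<Rightarrow> countable_ordinal"
    and \<alpha> \<beta> :: countable_ordinal
  assumes "schreier_choice lam"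
    and "\<beta> \<le> osuc \<alpha>"
    and "(\<alpha>, \<beta>) \<noteq> (0, 0)"
  shows "(\<exists>(V :: (nat \<Rightarrow> real) set) nrm e.
            quasi_greedy_basis_of_type lam \<alpha> \<beta> seq_scale V nrm e) \<and>
         (\<exists>(V :: (nat \<Rightarrow> complex) set) nrm e.
            quasi_greedy_basis_of_type lam \<alpha> \<beta> seq_scale V nrm e)"
proof -
  interpret schreier_families lam using assms(1) by unfold_locales
  show ?thesis by (intro conjI ex_quasi_greedy_basis_of_type)
qed

end
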